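(* Let $P_1,P_2$ be oriented paths with $P_1<P_2$ in the homomorphism order. If $h(P_2)\ge 4$, then the interval $[P_1,P_2]$ in the homomorphism order of oriented paths is universal. If $h(P_2)\le 3$, then the interval $[P_1,P_2]$ in the homomorphism order of oriented paths is a chain (any two of its elements are comparable).
   Context: All digraphs are finite. A homomorphism $f:G_1\to G_2$ between digraphs is a map $V(G_1)\to V(G_2)$ sending arcs to arcs; write $G_1\le G_2$ if one exists, and $G_1<G_2$ if $G_1\le G_2$ and $G_2\not\le G_1$. Identifying homomorphically equivalent digraphs makes $\le$ a partial order (the homomorphism order); restricting to a class (e.g. oriented paths) gives the homomorphism order of that class. An oriented path is a digraph whose vertices can be listed $p_0,\dots,p_n$ so that its arcs are exactly one arc between $p_{i-1}$ and $p_i$ (in either direction) for each $1\le i\le n$. $\vec P_k$ denotes the directed path with vertices $0,1,\dots,k$ and arcs $01,12,\dots,(k-1)k$. The height $h(P)$ of an oriented path $P$ is the minimum $k\ge0$ with $P\to\vec P_k$. For $P_1<P_2$, the interval $[P_1,P_2]$ in the homomorphism order of oriented paths is the set of (homomorphic equivalence classes of) oriented paths $P$ with $P_1\le P\le P_2$. A partial order is universal if it contains every countable partial order as a suborder. *)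

theory Defs
  imports Main "HOL-Library.Countable_Set"
begin

text \<open>A (finite) digraph is a pair (V, E) of a vertex set and an arc relation.
  Oriented paths are represented with natural-number vertices (every finite
  digraph is isomorphic to one on nat).\<close>

type_synonym 'v digraph = "'v set \<times> ('v \<times> 'v) set"

definition hom :: "'v digraph \<Rightarrow> 'w digraph \<Rightarrow> bool" where
  "hom G H \<longleftrightarrow> (\<exists>f. f ` fst G \<subseteq> fst H \<and>
      (\<forall>u v. (u, v) \<in> snd G \<longrightarrow> (f u, f v) \<in> snd H))"

definition hom_lt :: "'v digraph \<Rightarrow> 'w digraph \<Rightarrow> bool" where
  "hom_lt G H \<longleftrightarrow> hom G H \<and> \<not> hom H G"

definition oriented_path :: "nat digraph \<Rightarrow> bool" where
  "oriented_path G \<longleftrightarrow> (\<exists>(n::nat) (p::nat \<Rightarrow> nat). bij_betw p {0..n} (fst G) \<and>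
      (\<forall>i\<in>{1..n}. ((p (i - 1), p i) \<in> snd G \<longleftrightarrow> (p i, p (i - 1)) \<notin> snd G)) \<and>
      snd G \<subseteq> {(p (i - 1), p i) | i. i \<in> {1..n}} \<union> {(p i, p (i - 1)) | i. i \<in> {1..n}})"

definition dipath :: "nat \<Rightarrow> nat digraph" where
  "dipath k = ({0..k}, {(i, Suc i) | i. i < k})"

definition height :: "nat digraph \<Rightarrow> nat" where
  "height P = (LEAST k. hom P (dipath k))"

definition path_interval :: "nat digraph \<Rightarrow> nat digraph \<Rightarrow> nat digraph set" where
  "path_interval P1 P2 = {Q. oriented_path Q \<and> hom P1 Q \<and> hom Q P2}"

end

theory Submission
  imports Defs
begin

text \<open>An oriented path is encoded by the list of its levels, and a homomorphism is a walk in the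
  target reading the levels of the source. For height at least 4, any target that does not receive
  a path \<^term>\<open>F\<close> also rejects some path \<^term>\<open>Q\<close> below \<^term>\<open>F\<close> in which bottom and top
  are arbitrarily far apart: replace every passage of \<^term>\<open>F\<close> through levels 1, 2, 3 by two
  parallel delayed routes, one zigzagging between levels 1 and 2, the other between 2 and 3. A path
  into which both routes fold already contains a straight passage 1, 2, 3, so the delayed graph maps to
  a path only if \<^term>\<open>F\<close> does, and a graph maps to a path as soon as all its walks do.
  Such slow \<^term>\<open>Q\<close> receive no short path of full height. A given countable order, with a new
  least element sent to the lower end of the interval, is therefore embedded one element at a time:
  keep for every \<open>j\<close> a path that maps exactly to the \<open>W i\<close> with \<open>i\<close> not below \<open>j\<close>, and let the
  new element be the join of the elements below it and of slow variants of these separating paths.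
  Joins of paths are made with slow zigzag connectors common to all paths in play, which exist by
  the mountain climbing theorem. For height at most 3 a path is determined by its height and, when
  that is 3, by the distance between its bottom and its top.\<close>

subsection \<open>Walks and level lists\<close>

text \<open>Why 4: the delayed routes visit levels 1, 2, 3, and they keep bottom and top apart only
  if neither 0 nor \<open>h\<close> occurs on a route. At \<open>h = 3\<close> the upper route would
  already touch the top.

  Why slowness: the connectors of a join admit homomorphisms that no piece of the join admits. They
  cannot be made harmless, only long: a path with a bottom whose length stays within the slowness,
  and which maps to the join, maps to one of the pieces. So at each stage the separating path of the
  new element is fixed first, and its length dictates how slow everything added afterwards has to
  be. The old separating paths that enter the join must be slowed down as well, since the new one is
  a join of old ones and could map back to them. If only the least element lies below the new one,
  both could even have the same separating path.

  Why full height: the lower end of the interval may have smaller height than the upper one, and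
  connectors between bottom and top need both levels. The lower end is therefore first raised to a
  path of full height that is still strictly below the upper end.\<close>

definition adj :: "nat \<Rightarrow> nat \<Rightarrow> bool" where
  "adj i j \<longleftrightarrow> i = Suc j \<or> j = Suc i"

text \<open>Arcs raise the level by 1, so the signs of the differences are the orientations.
  Directions need not be mentioned again: maps that preserve levels and adjacency preserve
  arcs.\<close>

definition level_list :: "int list \<Rightarrow> bool" where
  "level_list xs \<longleftrightarrow> xs \<noteq> [] \<and> successively (\<lambda>a b. \<bar>a - b\<bar> = 1) xs"

definition walk :: "'a list \<Rightarrow> nat list \<Rightarrow> bool" where
  "walk ys is \<longleftrightarrow> is \<noteq> [] \<and> set is \<subseteq> {..<length ys} \<and> successively adj is"

text \<open>The end positions are kept, unlike in \<open>lhom\<close>, because they are what allows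
  readings to be concatenated.\<close>

definition reads :: "'a list \<Rightarrow> 'a list \<Rightarrow> nat \<Rightarrow> nat \<Rightarrow> bool" where
  "reads ys u p q \<longleftrightarrow> (\<exists>is. walk ys is \<and> hd is = p \<and> last is = q \<and> u = map ((!) ys) is)"

definition lhom :: "'a list \<Rightarrow> 'a list \<Rightarrow> bool" where
  "lhom u ys \<longleftrightarrow> (\<exists>p q. reads ys u p q)"

text \<open>Concatenation with the common entry at the joint counted once, meant for
  \<open>last u = hd v\<close>.\<close>

definition fuse :: "'a list \<Rightarrow> 'a list \<Rightarrow> 'a list" (infixr "\<diamondop>" 65) where
  "u \<diamondop> v = u @ tl v"

lemma adj_sym: "adj i j \<Longrightarrow> adj j i"
  by (auto simp: adj_def)

lemma adj_abs: "adj i j \<longleftrightarrow> \<bar>int i - int j\<bar> = 1"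
  by (auto simp: adj_def)

lemma readsI: "walk ys is \<Longrightarrow> reads ys (map ((!) ys) is) (hd is) (last is)"
  by (auto simp: reads_def)

lemma lhomI: "reads ys u p q \<Longrightarrow> lhom u ys"
  by (auto simp: lhom_def)

lemma reads_ends:
  assumes "reads ys u p q"
  shows "u \<noteq> []" "p < length ys" "q < length ys" "hd u = ys ! p" "last u = ys ! q" "set u \<subseteq> set ys"
proof -
  obtain "is" where i: "walk ys is" "hd is = p" "last is = q" "u = map ((!) ys) is"
    using assms unfolding reads_def by blast
  then have ne: "is \<noteq> []" and sub: "set is \<subseteq> {..<length ys}" by (auto simp: walk_def)
  show "u \<noteq> []" using i ne by simp
  show "p < length ys" using i(2) ne sub hd_in_set by fastforce
  show "q < length ys" using i(3) ne sub last_in_set by fastforce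
  show "hd u = ys ! p" "last u = ys ! q" using i ne by (auto simp: hd_map last_map)
  show "set u \<subseteq> set ys" using i(4) sub by auto
qed

lemma hd_fuse: "u \<noteq> [] \<Longrightarrow> hd (u \<diamondop> v) = hd u"
  by (simp add: fuse_def)

lemma last_fuse: "u \<noteq> [] \<Longrightarrow> v \<noteq> [] \<Longrightarrow> last u = hd v \<Longrightarrow> last (u \<diamondop> v) = last v"
  by (cases v) (auto simp: fuse_def last_append)

lemma set_fuse: "u \<noteq> [] \<Longrightarrow> v \<noteq> [] \<Longrightarrow> last u = hd v \<Longrightarrow> set (u \<diamondop> v) = set u \<union> set v"
  by (cases v) (auto simp: fuse_def)

lemma fuse_nonempty: "u \<noteq> [] \<Longrightarrow> u \<diamondop> v \<noteq> []"
  by (simp add: fuse_def)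

lemma length_fuse: "v \<noteq> [] \<Longrightarrow> length (u \<diamondop> v) = length u + length v - 1"
  by (cases v) (auto simp: fuse_def)

lemma nth_fuse_left: "i < length u \<Longrightarrow> (u \<diamondop> v) ! i = u ! i"
  by (simp add: fuse_def nth_append)

lemma nth_fuse_right:
  assumes "u \<noteq> []" "v \<noteq> []" "last u = hd v"
  shows "(u \<diamondop> v) ! (length u - 1 + i) = v ! i"
proof (cases i)
  case 0
  then show ?thesis using assms by (simp add: fuse_def nth_append last_conv_nth hd_conv_nth)
next
  case (Suc k)
  then show ?thesis using assms by (cases v; cases u) (auto simp: fuse_def nth_append)
qed

lemma rev_fuse:
  assumes "u \<noteq> []" "v \<noteq> []" "last u = hd v"
  shows "rev (u \<diamondop> v) = rev v \<diamondop> rev u"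
proof -
  obtain x v' where v: "v = x # v'" using assms by (cases v) auto
  obtain u' where u: "u = u' @ [x]" using assms v by (metis append_butlast_last_id list.sel(1))
  show ?thesis by (simp add: u v fuse_def)
qed

lemma successively_fuse:
  assumes "successively P u" "successively P v" "u \<noteq> []" "v \<noteq> []" "last u = hd v"
  shows "successively P (u \<diamondop> v)"
  using assms by (cases v) (auto simp: fuse_def successively_append_iff successively_Cons)

lemma walk_fuse:
  assumes "walk ys is" "walk ys js" "last is = hd js"
  shows "walk ys (is \<diamondop> js)"
  using assms unfolding walk_def
  by (auto simp: set_fuse fuse_nonempty intro: successively_fuse)

lemma walk_rev: "walk ys is \<Longrightarrow> walk ys (rev is)"
  unfolding walk_def by (auto elim: successively_mono simp: adj_def)

lemma reads_fuse:
  assumes "reads ys u p q" "reads ys v q r"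
  shows "reads ys (u \<diamondop> v) p r"
proof -
  obtain "is" where i: "walk ys is" "hd is = p" "last is = q" "u = map ((!) ys) is"
    using assms unfolding reads_def by blast
  obtain js where j: "walk ys js" "hd js = q" "last js = r" "v = map ((!) ys) js"
    using assms unfolding reads_def by blast
  have ne: "is \<noteq> []" "js \<noteq> []" using i j by (auto simp: walk_def)
  have "walk ys (is \<diamondop> js)" using i j by (auto intro: walk_fuse)
  moreover have "hd (is \<diamondop> js) = p" "last (is \<diamondop> js) = r" using i j ne by (auto simp: hd_fuse last_fuse)
  moreover have "u \<diamondop> v = map ((!) ys) (is \<diamondop> js)" using i j by (simp add: fuse_def map_tl)
  ultimately show ?thesis unfolding reads_def by blast
qed

lemma reads_rev: "reads ys u p q \<Longrightarrow> reads ys (rev u) q p"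
proof -
  assume "reads ys u p q"
  then obtain "is" where i: "walk ys is" "hd is = p" "last is = q" "u = map ((!) ys) is"
    unfolding reads_def by blast
  show ?thesis unfolding reads_def
    by (rule exI[of _ "rev is"]) (use i in \<open>auto simp: walk_rev hd_rev last_rev rev_map\<close>)
qed

lemma reads_single: "p < length ys \<Longrightarrow> reads ys [ys ! p] p p"
  unfolding reads_def by (rule exI[of _ "[p]"]) (auto simp: walk_def)

lemma reads_snoc:
  assumes "reads ys u p q" "adj q r" "r < length ys" 
  shows "reads ys (u @ [ys ! r]) p r"
proof -
  have "reads ys [ys ! q, ys ! r] q r" unfolding reads_def
    by (rule exI[of _ "[q, r]"]) (use assms reads_ends[OF assms(1)] in \<open>auto simp: walk_def\<close>)
  from reads_fuse[OF assms(1) this] show ?thesis by (simp add: fuse_def)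
qed

lemma successively_adj_upt: "successively adj [p..<q]"
  by (auto simp: successively_conv_nth adj_def)

lemma walk_upt: "p \<le> q \<Longrightarrow> q < length ys \<Longrightarrow> walk ys [p..<Suc q]"
  unfolding walk_def using successively_adj_upt by (auto simp del: upt_Suc)

lemma reads_between:
  assumes "p \<le> q" "q < length ys"
  shows "reads ys (map ((!) ys) [p..<Suc q]) p q"
proof -
  have "hd [p..<Suc q] = p" "last [p..<Suc q] = q" using assms by (auto simp: hd_conv_nth simp del: upt_Suc)
  then show ?thesis using readsI[OF walk_upt[OF assms]] by simp
qed

lemma reads_connect:
  assumes "p < length ys" "q < length ys"
  shows "\<exists>u. reads ys u p q"
  using reads_between[of p q] reads_rev[OF reads_between[of q p]] assms by (metis nat_le_linear)

lemma reads_refl: "xs \<noteq> [] \<Longrightarrow> reads xs xs 0 (length xs - 1)"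
  using reads_between[of 0 "length xs - 1" xs] by (simp add: map_nth del: upt_Suc)

lemma lhom_refl: "xs \<noteq> [] \<Longrightarrow> lhom xs xs"
  using reads_refl lhomI by blast

lemma reads_take:
  assumes "i < length xs" shows "reads xs (take (Suc i) xs) 0 i"
proof -
  have "map ((!) xs) [0..<Suc i] = take (Suc i) xs"
    using assms by (intro nth_equalityI) (auto simp del: upt_Suc)
  then show ?thesis using reads_between[of 0 i xs] assms by simp
qed

lemma reads_drop:
  assumes "i < length xs" shows "reads xs (drop i xs) i (length xs - 1)"
proof -
  have "map ((!) xs) [i..<length xs] = drop i xs"
    using assms by (intro nth_equalityI) auto
  moreover have "reads xs (map ((!) xs) [i..<Suc (length xs - 1)]) i (length xs - 1)"
    using assms by (intro reads_between) auto
  moreover have "Suc (length xs - 1) = length xs" using assms by simp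
  ultimately show ?thesis by metis
qed

lemma reads_level_list:
  assumes "level_list ys" "reads ys u p q" shows "level_list u"
proof -
  obtain "is" where i: "walk ys is" "u = map ((!) ys) is"
    using assms unfolding reads_def by blast
  have "successively (\<lambda>a b. \<bar>ys ! a - ys ! b\<bar> = 1) is"
  proof -
    have s: "successively adj is" and sub: "set is \<subseteq> {..<length ys}" using i by (auto simp: walk_def)
    show ?thesis
    proof (rule successively_mono[OF s])
      fix x y assume "x \<in> set is" "y \<in> set is" "adj x y"
      then show "\<bar>ys ! x - ys ! y\<bar> = 1" using sub assms(1)
        unfolding level_list_def successively_conv_nth adj_def
        by (metis abs_minus_commute lessThan_iff subsetD)
    qed
  qed
  then show ?thesis using i by (auto simp: level_list_def successively_map walk_def)
qed

text \<open>Passes between walks, which are easy to concatenate, and maps of positions, which are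
  easy to compose and to restrict.\<close>

lemma reads_iff_map:
  "reads ys u p q \<longleftrightarrow> u \<noteq> [] \<and> (\<exists>f. f 0 = p \<and> f (length u - 1) = q \<and>
     (\<forall>i<length u. f i < length ys \<and> ys ! f i = u ! i) \<and>
     (\<forall>i. Suc i < length u \<longrightarrow> adj (f i) (f (Suc i))))" (is "?L \<longleftrightarrow> ?R")
proof
  assume ?L
  then obtain "is" where i: "walk ys is" "hd is = p" "last is = q" "u = map ((!) ys) is"
    unfolding reads_def by blast
  then have ne: "is \<noteq> []" and "\<And>j. j < length is \<Longrightarrow> is ! j < length ys"
    using nth_mem by (fastforce simp: walk_def)+
  then show ?R
    by (intro conjI exI[of _ "(!) is"])
       (use i in \<open>auto simp: hd_conv_nth last_conv_nth walk_def successively_conv_nth\<close>)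
next
  assume ?R
  then obtain f where f: "u \<noteq> []" "f 0 = p" "f (length u - 1) = q"
     "\<forall>i<length u. f i < length ys \<and> ys ! f i = u ! i"
     "\<forall>i. Suc i < length u \<longrightarrow> adj (f i) (f (Suc i))" by blast
  let ?is = "map f [0..<length u]"
  have "walk ys ?is" using f unfolding walk_def
    by (auto simp: successively_conv_nth)
  moreover have "hd ?is = p" "last ?is = q" using f by (auto simp: hd_map last_map)
  moreover have "u = map ((!) ys) ?is" using f by (intro nth_equalityI) auto
  ultimately show ?L unfolding reads_def by blast
qed

lemma lhom_iff_map:
  "lhom u ys \<longleftrightarrow> u \<noteq> [] \<and> (\<exists>f. (\<forall>i<length u. f i < length ys \<and> ys ! f i = u ! i) \<and>
     (\<forall>i. Suc i < length u \<longrightarrow> adj (f i) (f (Suc i))))"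
  unfolding lhom_def reads_iff_map by blast

lemma reads_image:
  assumes f: "\<forall>i<length v. f i < length ys \<and> ys ! f i = v ! i"
     "\<forall>i. Suc i < length v \<longrightarrow> adj (f i) (f (Suc i))"
    and r: "reads v u p q"
  shows "reads ys u (f p) (f q)"
proof -
  obtain "is" where i: "walk v is" "hd is = p" "last is = q" "u = map ((!) v) is"
    using r unfolding reads_def by blast
  have s: "set is \<subseteq> {..<length v}" "is \<noteq> []" "successively adj is" using i by (auto simp: walk_def)
  have "successively (\<lambda>a b. adj (f a) (f b)) is"
    by (rule successively_mono[OF s(3)]) (use s(1) f(2) in \<open>auto simp: adj_def\<close>)
  then have "walk ys (map f is)" using s f by (auto simp: walk_def successively_map)
  moreover have "u = map ((!) ys) (map f is)" using i(4) f s(1) by auto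
  ultimately show ?thesis unfolding reads_def
    using i s by (intro exI[of _ "map f is"]) (auto simp: hd_map last_map)
qed

lemma lhom_image:
  assumes "lhom v ys"
  obtains f where "\<And>i. i < length v \<Longrightarrow> f i < length ys \<and> ys ! f i = v ! i"
    "\<And>u p q. reads v u p q \<Longrightarrow> reads ys u (f p) (f q)"
  using assms reads_image unfolding lhom_iff_map by metis

lemma lhom_trans: "lhom u v \<Longrightarrow> lhom v w \<Longrightarrow> lhom u w"
  by (metis lhom_def lhom_image)

lemma reads_trans:
  assumes "reads ys u p q" "reads u w 0 (length u - 1)" shows "reads ys w p q"
  using assms reads_image unfolding reads_iff_map[of ys u] by metis

lemma reads_mono_prefix:
  assumes "reads u w p q" shows "reads (u \<diamondop> v) w p q"
  using reads_image[OF _ _ assms, of id "u \<diamondop> v"]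
  by (auto simp: nth_fuse_left adj_def fuse_def nth_append)

lemma lhom_fuse_left: "u \<noteq> [] \<Longrightarrow> lhom u (u \<diamondop> v)"
  using reads_mono_prefix[OF reads_refl] lhomI by blast

lemma lhom_rev_right: "lhom u (rev v) \<longleftrightarrow> lhom u v"
proof -
  have *: "lhom u (rev v)" if "lhom u v" for u v :: "'a list"
  proof -
    have "v \<noteq> []" using that unfolding lhom_def using reads_ends(2) by fastforce
    then have "lhom (rev v) (rev v)" by (intro lhom_refl) auto
    then have "lhom v (rev v)" unfolding lhom_def using reads_rev by (metis rev_rev_ident)
    with that show ?thesis using lhom_trans by blast
  qed
  show ?thesis using *[of u v] *[of u "rev v"] by auto
qed

lemma lhom_rev_left: "lhom (rev u) v \<longleftrightarrow> lhom u v"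
  unfolding lhom_def using reads_rev by (metis rev_rev_ident)

lemma lhom_fuse_right:
  assumes "u \<noteq> []" "v \<noteq> []" "last u = hd v" shows "lhom v (u \<diamondop> v)"
proof -
  have "lhom (rev v) (rev v \<diamondop> rev u)" using assms by (intro lhom_fuse_left) auto
  then show ?thesis using rev_fuse[OF assms] by (metis lhom_rev_left lhom_rev_right)
qed

lemma int_lipschitz:
  fixes g :: "nat \<Rightarrow> int"
  assumes "\<And>i. Suc i < n \<Longrightarrow> \<bar>g i - g (Suc i)\<bar> \<le> 1" "i < n" "j < n"
  shows "\<bar>g i - g j\<bar> \<le> \<bar>int i - int j\<bar>"
proof -
  have *: "\<bar>g i - g j\<bar> \<le> int j - int i" if "i \<le> j" "j < n" for i j
    using that
  proof (induction j rule: dec_induct)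
    case (step j)
    then have "\<bar>g j - g (Suc j)\<bar> \<le> 1" using assms(1) by simp
    then show ?case using step by auto
  qed simp
  show ?thesis using *[of i j] *[of j i] assms by (cases "i \<le> j") auto
qed

lemma adj_lipschitz:
  assumes "\<forall>i. Suc i < n \<longrightarrow> adj (f i) (f (Suc i))" "i < n" "j < n"
  shows "\<bar>int (f i) - int (f j)\<bar> \<le> \<bar>int i - int j\<bar>"
  using assms by (intro int_lipschitz[of n "\<lambda>i. int (f i)"]) (auto simp: adj_abs)

lemma level_list_nth: "level_list xs \<Longrightarrow> Suc i < length xs \<Longrightarrow> \<bar>xs ! i - xs ! Suc i\<bar> = 1"
  by (auto simp: level_list_def successively_conv_nth)

lemma level_list_adj:
  "level_list xs \<Longrightarrow> i < length xs \<Longrightarrow> j < length xs \<Longrightarrow> adj i j \<Longrightarrow> \<bar>xs ! i - xs ! j\<bar> = 1"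
  using level_list_nth[of xs i] level_list_nth[of xs j] by (auto simp: adj_def)

lemma level_list_fuse:
  assumes "level_list u" "level_list v" "last u = hd v" shows "level_list (u \<diamondop> v)"
  using assms unfolding level_list_def by (auto simp: fuse_nonempty intro: successively_fuse)

lemma level_list_rev: "level_list (rev u) \<longleftrightarrow> level_list u"
  by (simp add: level_list_def abs_minus_commute)


subsection \<open>Mountain climbing and joins\<close>

text \<open>Inserting \<open>x\<close> adds its degree twice: once as its own, once spread over its
  neighbours.\<close>

lemma handshake:
  assumes "finite K" "\<And>v w. E v w \<Longrightarrow> E w v" "\<And>v. \<not> E v v"
  shows "even (\<Sum>v\<in>K. card {w \<in> K. E v w})"
  using assms(1)
proof (induction K)
  case (insert x K)
  have "card {w \<in> insert x K. E v w} = card {w \<in> K. E v w} + of_bool (E v x)" for v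
  proof -
    have "{w \<in> insert x K. E v w} = {w \<in> K. E v w} \<union> (if E v x then {x} else {})" by auto
    then show ?thesis using insert by auto
  qed
  moreover have "(\<Sum>v\<in>K. of_bool (E v x)) = card {w \<in> K. E x w}"
  proof -
    have "(\<Sum>v\<in>K. of_bool (E v x)) = (\<Sum>v\<in>{v\<in>K. E v x}. (1::nat))"
      using sum.inter_filter[OF insert(1), of "\<lambda>_. 1::nat" "\<lambda>v. E v x"] by (simp only: of_bool_def)
    also have "{v\<in>K. E v x} = {w \<in> K. E x w}" using assms(2) by blast
    finally show ?thesis by simp
  qed
  moreover have "\<not> E x x" by (rule assms(3))
  ultimately show ?case using insert by (simp add: sum.distrib)
qed simp

text \<open>A mountain of the climbing theorem. It may return to the bottom and touch the top on the
  way.\<close>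

definition crossing :: "int \<Rightarrow> int list \<Rightarrow> bool" where
  "crossing h x \<longleftrightarrow> level_list x \<and> set x \<subseteq> {0..h} \<and> hd x = 0 \<and> last x = h"

definition ups :: "int list \<Rightarrow> nat \<Rightarrow> nat set" where
  "ups x i = {j. j < length x \<and> adj i j \<and> x ! j = x ! i + 1}"

definition downs :: "int list \<Rightarrow> nat \<Rightarrow> nat set" where
  "downs x i = {j. j < length x \<and> adj i j \<and> x ! j = x ! i - 1}"

lemma finite_ups_downs: "finite (ups x i)" "finite (downs x i)"
  by (auto simp: ups_def downs_def)

lemma crossing_ends:
  assumes "crossing h x" shows "x \<noteq> []" "x ! 0 = 0" "x ! (length x - 1) = h"
  using assms unfolding crossing_def level_list_def by (auto simp: hd_conv_nth last_conv_nth)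

lemma card_ups_downs:
  assumes x: "crossing h x" and h: "h \<ge> 1" and i: "i < length x"
  shows "card (ups x i) + card (downs x i) = (if i = 0 \<or> i = length x - 1 then 1 else 2)"
    and "x ! i = 0 \<Longrightarrow> card (downs x i) = 0" and "x ! i = h \<Longrightarrow> card (ups x i) = 0"
proof -
  have l: "level_list x" and "set x \<subseteq> {0..h}" using x by (auto simp: crossing_def)
  then have r: "0 \<le> x ! j \<and> x ! j \<le> h" if "j < length x" for j
    using nth_mem[OF that] by auto
  have n: "length x \<ge> 2"
  proof (rule ccontr)
    assume "\<not> ?thesis"
    then have "length x - 1 = 0" by simp
    then show False using crossing_ends[OF x] h by simp
  qed
  have u: "ups x i \<union> downs x i = {j. j < length x \<and> adj i j}"
  proof -
    have "x ! j = x ! i + 1 \<or> x ! j = x ! i - 1" if "j < length x" "adj i j" for j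
      using level_list_adj[OF l i that] by linarith
    then show ?thesis by (auto simp: ups_def downs_def)
  qed
  have "card (ups x i \<union> downs x i) = card (ups x i) + card (downs x i)"
    by (intro card_Un_disjoint finite_ups_downs) (auto simp: ups_def downs_def)
  moreover have "{j. j < length x \<and> adj i j} =
     (if i = 0 then {1} else if i = length x - 1 then {i - 1} else {i - 1, Suc i})"
  proof (cases "i = 0 \<or> i = length x - 1")
    case True
    then show ?thesis using n unfolding adj_def by (intro set_eqI) (simp, arith)
  next
    case False
    then show ?thesis using n i unfolding adj_def by (intro set_eqI) (simp, arith)
  qed
  ultimately show "card (ups x i) + card (downs x i) = (if i = 0 \<or> i = length x - 1 then 1 else 2)"
    using u i n by (simp split: if_splits)
  show "card (downs x i) = 0" if "x ! i = 0"
  proof -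
    have "downs x i = {}" unfolding downs_def using that r by force
    then show ?thesis by simp
  qed
  show "card (ups x i) = 0" if "x ! i = h"
  proof -
    have "ups x i = {}" unfolding ups_def using that r by force
    then show ?thesis by simp
  qed
qed

text \<open>Pairs of positions at equal level form a graph all of whose degrees are even, except at the two
  pairs of ends; these lie in one component by the handshake lemma.\<close>

lemma mountain_climbing:
  assumes x: "crossing h x" and y: "crossing h y" and h: "h \<ge> 1"
  shows "\<exists>w. reads x w 0 (length x - 1) \<and> reads y w 0 (length y - 1)"
proof -
  define E where "E = (\<lambda>(i, j) (i', j'). i < length x \<and> i' < length x \<and> j < length y \<and> j' < length y \<and>
     x ! i = y ! j \<and> x ! i' = y ! j' \<and> adj i i' \<and> adj j j')"
  define K where "K = {v. E\<^sup>*\<^sup>* (0, 0) v}"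
  have lx: "level_list x" and ly: "level_list y" using x y by (auto simp: crossing_def)
  have K: "i < length x \<and> j < length y \<and> x ! i = y ! j" if "(i, j) \<in> K" for i j
  proof -
    have "E\<^sup>*\<^sup>* (0, 0) (i, j)" using that by (simp add: K_def)
    then show ?thesis
      by (cases rule: rtranclp.cases) (use crossing_ends[OF x] crossing_ends[OF y] in \<open>auto simp: E_def\<close>)
  qed
  have fin: "finite K"
    by (rule finite_subset[of _ "{..<length x} \<times> {..<length y}"]) (use K in auto)
  have "\<exists>w. reads x w 0 i \<and> reads y w 0 j" if "(i, j) \<in> K" for i j
  proof -
    have "E\<^sup>*\<^sup>* (0, 0) (i, j)" using that by (simp add: K_def)
    then show ?thesis
    proof (induction rule: rtranclp_induct2)
      case refl
      show ?case using reads_single[of 0 x] reads_single[of 0 y] crossing_ends[OF x] crossing_ends[OF y]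
        by auto
    next
      case (step i j i' j')
      then obtain w where w: "reads x w 0 i" "reads y w 0 j" by blast
      have e: "i' < length x" "j' < length y" "x ! i' = y ! j'" "adj i i'" "adj j j'"
        using step(2) by (auto simp: E_def)
      show ?case using reads_snoc[OF w(1) e(4,1)] reads_snoc[OF w(2) e(5,2)] e(3) by auto
    qed
  qed
  moreover have "(length x - 1, length y - 1) \<in> K"
  proof (rule ccontr)
    assume no: "(length x - 1, length y - 1) \<notin> K"
    \<comment> \<open>Both climbers step up or both step down, hence a sum of two products.\<close>
    have deg: "card {w \<in> K. E (i, j) w} = card (ups x i) * card (ups y j) + card (downs x i) * card (downs y j)"
      if v: "(i, j) \<in> K" for i j
    proof -
      have c: "w \<in> K" if "E (i, j) w" for w
        using v that unfolding K_def by auto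
      have "{w \<in> K. E (i, j) w} = {w. E (i, j) w}" using c by auto
      also have "\<dots> = ups x i \<times> ups y j \<union> downs x i \<times> downs y j" (is "_ = ?R")
      proof
        show "{w. E (i, j) w} \<subseteq> ?R"
        proof
          fix w assume "w \<in> {w. E (i, j) w}"
          then obtain i' j' where w: "w = (i', j')" and e: "i < length x" "i' < length x" "j < length y"
            "j' < length y" "x ! i = y ! j" "x ! i' = y ! j'" "adj i i'" "adj j j'"
            by (cases w) (auto simp: E_def)
          have "\<bar>x ! i - x ! i'\<bar> = 1" using level_list_adj[OF lx] e by blast
          then have "x ! i' = x ! i + 1 \<or> x ! i' = x ! i - 1" by linarith
          then show "w \<in> ?R" using w e by (auto simp: ups_def downs_def)
        qed
        show "?R \<subseteq> {w. E (i, j) w}" using K[OF v] by (auto simp: E_def ups_def downs_def)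
      qed
      finally have "{w \<in> K. E (i, j) w} = ups x i \<times> ups y j \<union> downs x i \<times> downs y j" .
      moreover have "ups x i \<times> ups y j \<inter> downs x i \<times> downs y j = {}"
        by (auto simp: ups_def downs_def)
      ultimately show ?thesis
        by (simp add: card_Un_disjoint finite_ups_downs card_cartesian_product)
    qed
    have ev: "even (card {w \<in> K. E v w})" if v: "v \<in> K" "v \<noteq> (0, 0)" for v
    proof -
      obtain i j where ij: "v = (i, j)" by fastforce
      note k = K[OF v(1)[unfolded ij]]
      have ne: "\<not> (i = length x - 1 \<and> j = length y - 1)" using no v ij by auto
      note cx = card_ups_downs[OF x h, of i] and cy = card_ups_downs[OF y h, of j]
      note ex = crossing_ends[OF x] and ey = crossing_ends[OF y]
      \<comment> \<open>An end of one path forces level 0 or \<open>h\<close>. There one product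
        vanishes, and the other has a factor 2 unless both climbers are at ends. Otherwise both
        degrees are 2, and \<open>a * b + (2 - a) * (2 - b)\<close> is even.\<close>
      consider (bottom) "x ! i = 0" "i = 0 \<or> j = 0" | (top) "x ! i = h" "i = length x - 1 \<or> j = length y - 1"
        | (mid) "i \<noteq> 0" "j \<noteq> 0" "i \<noteq> length x - 1" "j \<noteq> length y - 1"
        using k ex ey by metis
      then have "even (card (ups x i) * card (ups y j) + card (downs x i) * card (downs y j))"
      proof cases
        case bottom
        have "i \<noteq> length x - 1" "j \<noteq> length y - 1"
          using bottom k ex ey h by (metis zero_neq_one not_one_le_zero)+
        then have "card (ups x i) = (if i = 0 then 1 else 2)" "card (ups y j) = (if j = 0 then 1 else 2)"
          "card (downs x i) = 0" using cx cy k bottom by auto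
        then show ?thesis using bottom v ij by auto
      next
        case top
        have "i \<noteq> 0" "j \<noteq> 0"
          using top k ex ey h by (metis not_one_le_zero)+
        then have "card (downs x i) = (if i = length x - 1 then 1 else 2)"
          "card (downs y j) = (if j = length y - 1 then 1 else 2)"
          "card (ups x i) = 0" using cx cy k top by auto
        then show ?thesis using top ne by auto
      next
        case mid
        then have "card (ups x i) + card (downs x i) = 2" "card (ups y j) + card (downs y j) = 2"
          using cx cy k by auto
        then have "card (downs x i) = 2 - card (ups x i)" "card (downs y j) = 2 - card (ups y j)"
          "card (ups x i) \<in> {0,1,2}" "card (ups y j) \<in> {0,1,2}" by auto
        then show ?thesis by auto
      qed
      then show ?thesis using deg v ij by simp
    qed
    have z: "(0, 0) \<in> K" by (simp add: K_def)
    have "card (ups x 0) = 1" "card (downs x 0) = 0" "card (ups y 0) = 1"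
      using card_ups_downs[OF x h, of 0] card_ups_downs[OF y h, of 0] crossing_ends[OF x] crossing_ends[OF y]
      by auto
    then have "card {w \<in> K. E (0, 0) w} = 1" using deg[OF z] by simp
    moreover have "even (\<Sum>v\<in>K - {(0, 0)}. card {w \<in> K. E v w})"
      by (rule dvd_sum) (use ev in auto)
    ultimately have "odd (\<Sum>v\<in>K. card {w \<in> K. E v w})"
      using sum.remove[OF fin z, of "\<lambda>v. card {w \<in> K. E v w}"] by simp
    moreover have "even (\<Sum>v\<in>K. card {w \<in> K. E v w})"
      by (rule handshake[OF fin]) (auto simp: E_def adj_def)
    ultimately show False by simp
  qed
  ultimately show ?thesis by blast
qed

lemma crossing_reads:
  assumes "level_list X" "set X \<subseteq> {0..h}" "reads X u p t" "X ! p = 0" "X ! t = h"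
  shows "crossing h u"
  using assms(2,4,5) reads_level_list[OF assms(1,3)] reads_ends[OF assms(3)] unfolding crossing_def by auto

lemma level_list_upto: "a \<le> b \<Longrightarrow> level_list [a..b]"
  unfolding level_list_def by (auto simp: successively_conv_nth)

text \<open>A walk that climbs two mountains at once is again a crossing, and readings compose, so a
  further mountain can be climbed without losing the earlier ones.\<close>

lemma common_crossing:
  assumes "finite L" "\<And>x. x \<in> L \<Longrightarrow> crossing h x" "h \<ge> 1"
  shows "\<exists>z. crossing h z \<and> (\<forall>x\<in>L. reads x z 0 (length x - 1))"
  using assms(1,2)
proof (induction L)
  case empty
  have "crossing h [0..h]" using assms(3) level_list_upto[of 0 h]
    by (auto simp: crossing_def hd_conv_nth last_conv_nth)
  then show ?case by auto
next
  case (insert x L)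
  then obtain z where z: "crossing h z" "\<forall>x\<in>L. reads x z 0 (length x - 1)" by auto
  obtain w where w: "reads x w 0 (length x - 1)" "reads z w 0 (length z - 1)"
    using mountain_climbing[OF _ z(1) assms(3), of x] insert by auto
  have "crossing h w"
    using crossing_reads[OF _ _ w(2)] crossing_ends[OF z(1)] z(1) by (auto simp: crossing_def)
  moreover have "reads x' w 0 (length x' - 1)" if "x' \<in> L" for x'
    using reads_trans[OF _ w(2)] z(2) that by auto
  ultimately show ?case using w by auto
qed

section \<open>Slowness, slow connectors and joins\<close>

definition slow :: "int \<Rightarrow> nat \<Rightarrow> int list \<Rightarrow> bool" where
  "slow h K xs \<longleftrightarrow> (\<forall>i<length xs. \<forall>j<length xs. xs ! i = 0 \<longrightarrow> xs ! j = h \<longrightarrow> int K \<le> \<bar>int i - int j\<bar>)"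

text \<open>Homomorphisms between paths do not increase distances, so slowness passes from the
  target to the source.\<close>

lemma lhom_slow:
  assumes "lhom xs ys" "slow h K ys" shows "slow h K xs"
proof -
  obtain f where f: "\<forall>i<length xs. f i < length ys \<and> ys ! f i = xs ! i"
    "\<forall>i. Suc i < length xs \<longrightarrow> adj (f i) (f (Suc i))" using assms(1) unfolding lhom_iff_map by blast
  show ?thesis unfolding slow_def
  proof (intro allI impI)
    fix i j assume a: "i < length xs" "j < length xs" "xs ! i = 0" "xs ! j = h"
    then have "int K \<le> \<bar>int (f i) - int (f j)\<bar>" using f(1) assms(2) by (auto simp: slow_def)
    also have "\<dots> \<le> \<bar>int i - int j\<bar>" using adj_lipschitz[OF f(2)] a by blast
    finally show "int K \<le> \<bar>int i - int j\<bar>" .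
  qed
qed

text \<open>The delay is spent on levels 1 and 2, which lie strictly between 0 and \<open>h\<close>
  because \<open>h \<ge> 3\<close>. The levels 0 and \<open>h\<close> then occur at the two ends
  only.\<close>

lemma slow_crossing_exists:
  assumes "h \<ge> 3" shows "\<exists>x. crossing h x \<and> slow h K x"
proof -
  define t where "t k = concat (replicate k [1, 2]) @ [1..h]" for k :: nat
  have t: "hd (t k) = 1 \<and> level_list (t k)" for k
  proof (induction k)
    case 0
    show ?case using assms level_list_upto[of 1 h] by (simp add: t_def hd_conv_nth)
  next
    case (Suc k)
    have "t (Suc k) = 1 # 2 # t k" by (simp add: t_def)
    then show ?case using Suc by (auto simp: level_list_def successively_Cons)
  qed
  have s: "set (t k) \<subseteq> {1..h}" for k using assms by (auto simp: t_def)
  have split: "t K = (concat (replicate K [1, 2]) @ [1..h-1]) @ [h]"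
    using assms upto_rec2[of 1 h] by (simp add: t_def)
  let ?x = "0 # t K"
  have "crossing h ?x" unfolding crossing_def
    using t[of K] s[of K] assms split by (auto simp: level_list_def successively_Cons)
  moreover have "slow h K ?x"
    unfolding slow_def
  proof (intro allI impI)
    fix i j assume a: "i < length ?x" "j < length ?x" "?x ! i = 0" "?x ! j = h"
    have i: "i = 0"
    proof (rule ccontr)
      assume "i \<noteq> 0"
      then have "?x ! i \<in> set (t K)" using a(1) by (cases i) auto
      then show False using a(3) s[of K] by auto
    qed
    have len: "length ?x = 2 * K + nat (h - 1) + 2" using assms
      by (simp add: split length_concat sum_list_replicate)
    have "j = length ?x - 1"
    proof (rule ccontr)
      let ?b = "0 # concat (replicate K [1, 2]) @ [1..h-1]"
      assume "j \<noteq> length ?x - 1"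
      then have "j < length ?b" using a(2) split by simp
      moreover have "?x = ?b @ [h]" using split by simp
      ultimately have "?x ! j \<in> set ?b" by (metis nth_append nth_mem)
      moreover have "set ?b \<subseteq> {0..h-1}" using assms by auto
      ultimately show False using a(4) by fastforce
    qed
    then show "int K \<le> \<bar>int i - int j\<bar>" using i len by simp
  qed
  ultimately show ?thesis by blast
qed

text \<open>There are finitely many triples of a target, a bottom and a top in it. Choose a
  connecting walk for each, add one slow crossing, and climb them all at once: the common crossing
  can be read along each connecting walk, and it is slow because it maps to the slow one.\<close>

lemma slow_connector:
  assumes T: "finite T" "\<And>X. X \<in> T \<Longrightarrow> level_list X \<and> set X \<subseteq> {0..h}" and h: "h \<ge> 3"
  shows "\<exists>z. crossing h z \<and> slow h K z \<and>
    (\<forall>X\<in>T. \<forall>p<length X. \<forall>t<length X. X ! p = 0 \<longrightarrow> X ! t = h \<longrightarrow> reads X z p t)"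
proof -
  define I where "I = (SIGMA X:T. {(p, t). p < length X \<and> t < length X \<and> X ! p = 0 \<and> X ! t = h})"
  define c :: "int list \<times> nat \<times> nat \<Rightarrow> int list"
    where "c = (\<lambda>(X, p, t). SOME u. reads X u p t)"
  have c: "reads X (c (X, p, t)) p t" if "(X, p, t) \<in> I" for X p t
    unfolding c_def prod.case by (rule someI_ex, rule reads_connect) (use that in \<open>auto simp: I_def\<close>)
  obtain s where s: "crossing h s" "slow h K s" using slow_crossing_exists[OF h] by blast
  have "finite I" unfolding I_def
  proof (rule finite_SigmaI[OF T(1)])
    fix X :: "int list"
    show "finite {(p, t). p < length X \<and> t < length X \<and> X ! p = 0 \<and> X ! t = h}"
      by (rule finite_subset[of _ "{..<length X} \<times> {..<length X}"]) auto
  qed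
  then have "finite (insert s (c ` I))" by simp
  moreover have "crossing h x" if "x \<in> insert s (c ` I)" for x
  proof -
    have "crossing h (c (X, p, t))" if i: "(X, p, t) \<in> I" for X p t
      using crossing_reads[OF _ _ c[OF i]] i T(2) by (auto simp: I_def)
    then show ?thesis using that s by force
  qed
  ultimately obtain z where z: "crossing h z" "\<forall>x\<in>insert s (c ` I). reads x z 0 (length x - 1)"
    using common_crossing[of "insert s (c ` I)" h] h by auto
  have "slow h K z" using z(2) s lhom_slow lhomI by blast
  moreover have "reads X z p t" if "X \<in> T" "p < length X" "t < length X" "X ! p = 0" "X ! t = h" for X p t
  proof -
    have i: "(X, p, t) \<in> I" using that by (auto simp: I_def)
    show ?thesis using reads_trans[OF c[OF i]] z(2) i by auto
  qed
  ultimately show ?thesis using z(1) by blast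
qed

text \<open>Both ends are at the bottom so that two such lists can be glued by a connector going up
  and another coming down. Up to equivalence every path of height \<open>h\<close> has this form,
  see \<open>peaked_equivalent\<close>.\<close>

definition peaked :: "int \<Rightarrow> int list \<Rightarrow> bool" where
  "peaked h xs \<longleftrightarrow> level_list xs \<and> set xs \<subseteq> {0..h} \<and> hd xs = 0 \<and> last xs = 0 \<and> h \<in> set xs"

lemma peakedD:
  assumes "peaked h xs"
  shows "xs \<noteq> []" "xs ! 0 = 0" "xs ! (length xs - 1) = 0" "\<exists>t<length xs. xs ! t = h" "0 \<in> set xs"
proof -
  show ne: "xs \<noteq> []" and "\<exists>t<length xs. xs ! t = h"
    using assms by (auto simp: peaked_def level_list_def in_set_conv_nth)
  then show "xs ! 0 = 0" "xs ! (length xs - 1) = 0" "0 \<in> set xs"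
    using assms hd_in_set[OF ne] by (auto simp: peaked_def hd_conv_nth last_conv_nth)
qed

lemma slow_long:
  assumes "peaked h xs" "slow h K xs" shows "K < length xs"
proof -
  obtain t where "t < length xs" "xs ! t = h" using peakedD[OF assms(1)] by blast
  moreover have "0 < length xs" "xs ! 0 = 0" using peakedD[OF assms(1)] by auto
  ultimately have "int K \<le> \<bar>int 0 - int t\<bar>" using assms(2) unfolding slow_def by blast
  then show ?thesis using \<open>t < length xs\<close> by simp
qed

text \<open>Discrete intermediate value theorem: steps of size 1 cannot jump over
  \<open>c\<close>.\<close>

lemma adj_avoid:
  assumes "\<forall>i. Suc i < n \<longrightarrow> adj (f i) (f (Suc i))" "\<forall>i<n. f i \<noteq> c"
  shows "(\<forall>i<n. f i < c) \<or> (\<forall>i<n. f i > c)"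
proof -
  have "i < n \<Longrightarrow> (f i < c \<longleftrightarrow> f 0 < c)" for i
  proof (induction i)
    case (Suc i)
    then have "adj (f i) (f (Suc i))" "f i \<noteq> c" "f (Suc i) \<noteq> c" using assms by auto
    then show ?case using Suc by (auto simp: adj_def)
  qed simp
  then show ?thesis using assms(2) by (metis linorder_neqE_nat)
qed

text \<open>The join is \<^term>\<open>A\<close>, a slow connector up and down again, and \<^term>\<open>B\<close>. A short \<^term>\<open>F\<close>
  with a bottom cannot reach the peak of the connector, so its image folds back into one side.\<close>

lemma join2:
  assumes A: "peaked h A" and B: "peaked h B" and T: "finite T" "\<And>X. X \<in> T \<Longrightarrow> peaked h X" and h: "h \<ge> 3"
  shows "\<exists>J. peaked h J \<and> lhom A J \<and> lhom B J \<and> (\<forall>X\<in>T. lhom A X \<longrightarrow> lhom B X \<longrightarrow> lhom J X) \<and>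
    (\<forall>F. 0 \<in> set F \<longrightarrow> length F \<le> K \<longrightarrow> lhom F J \<longrightarrow> lhom F A \<or> lhom F B)"
proof -
  have "level_list X \<and> set X \<subseteq> {0..h}" if "X \<in> insert A (insert B T)" for X
    using that A B T(2) by (auto simp: peaked_def)
  moreover have "finite (insert A (insert B T))" using T(1) by simp
  \<comment> \<open>\<open>A\<close> and \<open>B\<close> are among the targets as well, so that the
    connector folds back into each of them.\<close>
  ultimately obtain z where z: "crossing h z" "slow h K z"
    and r: "\<forall>X\<in>insert A (insert B T). \<forall>p<length X. \<forall>t<length X. X ! p = 0 \<longrightarrow> X ! t = h \<longrightarrow> reads X z p t"
    using slow_connector[where K = K and T = "insert A (insert B T)" and h = h] h by metis
  have rd: "reads X z p t"
    if "X \<in> insert A (insert B T)" "p < length X" "t < length X" "X ! p = 0" "X ! t = h" for X p t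
    using r[rule_format, OF that] .
  note zn = crossing_ends[OF z(1)]
  note An = peakedD[OF A] and Bn = peakedD[OF B]
  have ends: "hd A = 0" "last A = 0" "hd B = 0" "last B = 0" "hd z = 0" "last z = h"
    using A B z by (auto simp: peaked_def crossing_def)
  define U where "U = A \<diamondop> z"
  define V where "V = rev z \<diamondop> B"
  have U: "U \<noteq> []" "last U = h" "hd U = 0" "length U = length A + length z - 1"
    unfolding U_def using An zn ends by (auto simp: fuse_nonempty last_fuse hd_fuse length_fuse)
  have V: "V \<noteq> []" "hd V = h" "last V = 0"
    unfolding V_def using Bn zn ends by (auto simp: fuse_nonempty last_fuse hd_fuse last_rev hd_rev)
  define J where "J = U \<diamondop> V"
  define c where "c = length U - 1"
  have joint: "last U = hd V" using U V by simp
  have lev: "level_list A" "level_list B" "level_list z" using A B z by (auto simp: peaked_def crossing_def)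
  have "level_list U" "level_list V" unfolding U_def V_def
    by (rule level_list_fuse; use lev ends zn in \<open>simp add: level_list_rev last_rev\<close>)+
  then have "level_list J" unfolding J_def using joint by (rule level_list_fuse)
  moreover have "set J = set A \<union> set z \<union> set B"
    unfolding J_def using U V joint An Bn zn ends
    by (simp add: set_fuse) (auto simp: U_def V_def set_fuse last_rev)
  moreover have "hd J = 0" "last J = 0" unfolding J_def using U V joint by (auto simp: hd_fuse last_fuse)
  ultimately have "peaked h J" using A B z by (auto simp: peaked_def crossing_def)
  moreover have "lhom A J"
    using lhom_trans[of A U J] lhom_fuse_left[of A z] lhom_fuse_left[of U V] An U by (simp add: J_def U_def)
  moreover have "lhom B J"
    using lhom_trans[of B V J] lhom_fuse_right[of "rev z" B] lhom_fuse_right[of U V] Bn zn U V joint ends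
    by (simp add: J_def V_def last_rev)
  moreover have "lhom J X" if X: "X \<in> T" and AX: "lhom A X" and BX: "lhom B X" for X
  proof -
    obtain a a' where a: "reads X A a a'" using AX by (auto simp: lhom_def)
    obtain b b' where b: "reads X B b b'" using BX by (auto simp: lhom_def)
    obtain t where t: "t < length X" "X ! t = h" using peakedD[OF T(2)[OF X]] by blast
    have "reads X z a' t" "reads X z b t"
      using rd[of X] X t reads_ends[OF a] reads_ends[OF b] ends by auto
    then have "reads X J a b'" unfolding J_def U_def V_def
      using a b by (intro reads_fuse) (auto intro: reads_rev)
    then show ?thesis by (rule lhomI)
  qed
  moreover have "lhom F A \<or> lhom F B" if F: "0 \<in> set F" "length F \<le> K" "lhom F J" for F
  proof -
    obtain f where f: "\<forall>i<length F. f i < length J \<and> J ! f i = F ! i"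
      "\<forall>i. Suc i < length F \<longrightarrow> adj (f i) (f (Suc i))" and Fne: "F \<noteq> []"
      using F(3) unfolding lhom_iff_map by blast
    have zs: "int K \<le> \<bar>int s - int (length z - 1)\<bar>" if "s < length z" "z ! s = 0" for s
      using z(2)[unfolded slow_def, rule_format, of s "length z - 1"] zn that by simp
    from this[of 0] zn have kz: "K \<le> length z - 1" by simp
    have lenJ: "length J = c + length V" using U(1) V(1) by (cases U) (auto simp: J_def c_def length_fuse)
    have cz: "c = length A - 1 + (length z - 1)" using An zn U by (cases A; cases z) (auto simp: c_def)
    \<comment> \<open>\<open>c\<close> is the peak in the middle of \<open>J\<close>. Every bottom
      of \<open>J\<close> is at distance at least \<open>K\<close> from it: on the connector by
      slowness, and inside \<open>A\<close> or \<open>B\<close> because a whole connector lies in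
      between. The image of \<open>F\<close> contains a bottom and is too short to reach the
      peak.\<close>
    have "f j \<noteq> c" if j: "j < length F" for j
    proof
      assume fj: "f j = c"
      obtain i where i: "i < length F" "F ! i = 0" using F(1) by (auto simp: in_set_conv_nth)
      have x: "f i < length J" "J ! f i = 0" using f i by auto
      have "\<bar>int (f i) - int c\<bar> < int K"
        using adj_lipschitz[OF f(2) i(1) j] fj i j F(2) by linarith
      moreover have "int K \<le> \<bar>int (f i) - int c\<bar>"
      proof (cases "f i \<le> c")
        case True
        then have "f i < length U" using U(1) by (cases U) (auto simp: c_def)
        then have J: "J ! f i = U ! f i" by (simp add: J_def nth_fuse_left)
        show ?thesis
        proof (cases "f i \<ge> length A - 1")
          case True
          define s where "s = f i - (length A - 1)"
          have s: "f i = length A - 1 + s" using True by (simp add: s_def)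
          then have "z ! s = 0" using x J nth_fuse_right[of A z s] An zn ends by (simp add: U_def)
          moreover have "s < length z" using s \<open>f i \<le> c\<close> cz zn by (cases z) auto
          ultimately have "int K \<le> \<bar>int s - int (length z - 1)\<bar>" by (intro zs)
          then show ?thesis using s cz by simp
        next
          case False
          then show ?thesis using kz cz by linarith
        qed
      next
        case False
        define s where "s = f i - c"
        have s: "f i = c + s" using False by (simp add: s_def)
        have "J ! f i = V ! s" unfolding s J_def c_def using U(1) V(1) joint by (rule nth_fuse_right)
        then have v: "V ! s = 0" using x by simp
        show ?thesis
        proof (cases "s < length z")
          case True
          then have "z ! (length z - Suc s) = 0" using v by (simp add: V_def nth_fuse_left rev_nth)
          moreover have "length z - Suc s < length z" using True by simp
          ultimately have "int K \<le> \<bar>int (length z - Suc s) - int (length z - 1)\<bar>" by (intro zs)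
          then show ?thesis using s True by simp
        next
          case False
          then show ?thesis using kz s by linarith
        qed
      qed
      ultimately show False by simp
    qed
    then consider "\<forall>i<length F. f i < c" | "\<forall>i<length F. f i > c"
      using adj_avoid[OF f(2), of c] by blast
    then show ?thesis
    proof cases
      case 1
      have "f i < length U \<and> U ! f i = F ! i" if i: "i < length F" for i
      proof -
        have "f i < length U" using 1 i by (fastforce simp: c_def)
        then show ?thesis using f(1) i nth_fuse_left[of "f i" U V] by (simp add: J_def)
      qed
      then have "lhom F U" unfolding lhom_iff_map using f(2) Fne by blast
      moreover have "lhom U A"
      proof -
        obtain t where "t < length A" "A ! t = h" using An by blast
        then have "reads A z (length A - 1) t" using rd An by simp
        then show ?thesis using reads_fuse[OF reads_refl[OF An(1)]] lhomI unfolding U_def by blast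
      qed
      ultimately show ?thesis using lhom_trans by blast
    next
      case 2
      have nth: "J ! (c + k) = V ! k" for k
        unfolding J_def c_def using U(1) V(1) joint by (rule nth_fuse_right)
      have "lhom F V" unfolding lhom_iff_map
      proof (intro conjI exI[of _ "\<lambda>i. f i - c"] allI impI)
        show "F \<noteq> []" by (rule Fne)
        fix i assume i: "i < length F"
        then have "f i = c + (f i - c)" using 2 by fastforce
        then have "J ! f i = V ! (f i - c)" using nth[of "f i - c"] by simp
        then show "V ! (f i - c) = F ! i" using f i by simp
        show "f i - c < length V" using f(1) i lenJ 2 by fastforce
      next
        fix i assume i: "Suc i < length F"
        then show "adj (f i - c) (f (Suc i) - c)" using f(2) 2 by (fastforce simp: adj_def)
      qed
      moreover have "lhom V B"
      proof -
        obtain t where "t < length B" "B ! t = h" using Bn by blast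
        then have "reads B (rev z) t 0" using rd Bn by (intro reads_rev) auto
        then show ?thesis using reads_fuse[OF _ reads_refl[OF Bn(1)]] lhomI unfolding V_def by blast
      qed
      ultimately show ?thesis using lhom_trans by blast
    qed
  qed
  ultimately show ?thesis by blast
qed

text \<open>A least upper bound with respect to the targets in \<open>T\<close> only, which suffices
  because each stage of the construction knows its finitely many targets. The last clause says that
  short paths with a bottom are join-prime; \<open>K\<close> and \<open>T\<close> stay fixed while
  the members of \<open>S\<close> are joined one by one.\<close>

lemma join_exists:
  assumes "finite S" "S \<noteq> {}" "\<And>A. A \<in> S \<Longrightarrow> peaked h A"
    and T: "finite T" "\<And>X. X \<in> T \<Longrightarrow> peaked h X" and h: "h \<ge> 3"
  shows "\<exists>J. peaked h J \<and> (\<forall>A\<in>S. lhom A J) \<and> (\<forall>X\<in>T. (\<forall>A\<in>S. lhom A X) \<longrightarrow> lhom J X) \<and>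
    (\<forall>F. 0 \<in> set F \<longrightarrow> length F \<le> K \<longrightarrow> lhom F J \<longrightarrow> (\<exists>A\<in>S. lhom F A))"
  using assms(1-3)
proof (induction S rule: finite_ne_induct)
  case (singleton A)
  then have "lhom A A" using lhom_refl peakedD(1) by blast
  then show ?case using singleton by blast
next
  case (insert A S)
  then obtain J where J: "peaked h J" "\<forall>A\<in>S. lhom A J" "\<forall>X\<in>T. (\<forall>A\<in>S. lhom A X) \<longrightarrow> lhom J X"
    "\<forall>F. 0 \<in> set F \<longrightarrow> length F \<le> K \<longrightarrow> lhom F J \<longrightarrow> (\<exists>A\<in>S. lhom F A)" by auto
  have "peaked h A" using insert by blast
  from join2[OF this J(1) T h, of K] obtain J' where J': "peaked h J'" "lhom A J'" "lhom J J'"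
    "\<forall>X\<in>T. lhom A X \<longrightarrow> lhom J X \<longrightarrow> lhom J' X"
    "\<forall>F. 0 \<in> set F \<longrightarrow> length F \<le> K \<longrightarrow> lhom F J' \<longrightarrow> lhom F A \<or> lhom F J" by blast
  then show ?case using J lhom_trans by (intro exI[of _ J']) (auto, blast+)
qed


subsection \<open>Path duality\<close>

definition walk_to :: "('v \<Rightarrow> 'v \<Rightarrow> bool) \<Rightarrow> 'v \<Rightarrow> 'v list \<Rightarrow> 'v \<Rightarrow> bool" where
  "walk_to E v\<^sub>0 w v \<longleftrightarrow> w \<noteq> [] \<and> hd w = v\<^sub>0 \<and> last w = v \<and> successively E w"

lemma walk_to_snoc: "walk_to E a w u \<Longrightarrow> E u v \<Longrightarrow> walk_to E a (w @ [v]) v"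
  by (auto simp: walk_to_def successively_append_iff)

lemma reads_snocD:
  assumes "reads ys (u @ [x]) p r" "u \<noteq> []"
  shows "\<exists>q. reads ys u p q \<and> adj q r"
proof -
  obtain "is" where i: "walk ys is" "hd is = p" "last is = r" "u @ [x] = map ((!) ys) is"
    using assms(1) unfolding reads_def by blast
  define js where "js = butlast is"
  have ne: "is \<noteq> []" using i(1) by (simp add: walk_def)
  then have is_eq: "is = js @ [r]" using i(3) by (metis append_butlast_last_id js_def)
  have u: "u = map ((!) ys) js" using i(4) by (simp add: is_eq)
  then have js: "js \<noteq> []" using assms(2) by auto
  have "walk ys js" "adj (last js) r"
    using i(1) js by (auto simp: walk_def is_eq successively_append_iff)
  moreover have "hd js = p" using i(2) js by (simp add: is_eq)
  ultimately show ?thesis using u unfolding reads_def by blast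
qed

text \<open>Send \<open>v\<close> to the maximum, over all walks to \<open>v\<close>, of the least position at which the walk can end
  in \<^term>\<open>ys\<close>. Prolonging a walk by one edge lowers its least end by at most 1, so adjacent vertices
  get positions that differ by at most 1, and by levels they are not equal.\<close>

lemma path_duality:
  fixes lev :: "'v \<Rightarrow> int"
  assumes sym: "\<And>u v. E u v \<Longrightarrow> E v u" and ys: "level_list ys"
    and all: "\<And>w v. walk_to E a w v \<Longrightarrow> lhom (map lev w) ys"
  obtains f where "\<And>w v. walk_to E a w v \<Longrightarrow> f v < length ys \<and> ys ! f v = lev v"
    "\<And>w u v. walk_to E a w u \<Longrightarrow> E u v \<Longrightarrow> adj (f u) (f v)"
proof -
  define ends where "ends w = {q. \<exists>p. reads ys (map lev w) p q}" for w
  define m where "m w = Min (ends w)" for w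
  define f where "f v = Max (m ` {w. walk_to E a w v})" for v
  have sub: "ends w \<subseteq> {..<length ys}" for w unfolding ends_def using reads_ends(3) by auto
  then have fin: "finite (ends w)" for w using finite_subset by blast
  have m: "m w \<in> ends w" "q \<in> ends w \<Longrightarrow> m w \<le> q" if "walk_to E a w v" for w v q
  proof -
    have "ends w \<noteq> {}" using all[OF that] by (auto simp: ends_def lhom_def)
    then show "m w \<in> ends w" "q \<in> ends w \<Longrightarrow> m w \<le> q" unfolding m_def using fin by auto
  qed
  \<comment> \<open>There may be infinitely many walks to \<open>v\<close>, but the values are
    positions of \<open>ys\<close>, so the maximum exists.\<close>
  have finm: "finite (m ` {w. walk_to E a w v})" for v
    by (rule finite_subset[of _ "{..<length ys}"]) (use m(1) sub in auto)
  have f: "\<exists>w. walk_to E a w v \<and> m w = f v" if "walk_to E a w v" for w v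
  proof -
    have "m ` {w. walk_to E a w v} \<noteq> {}" using that by blast
    from Max_in[OF finm this] show ?thesis unfolding f_def by auto
  qed
  have fge: "m w \<le> f v" if "walk_to E a w v" for w v
    unfolding f_def by (rule Max_ge[OF finm]) (use that in auto)
  have lev: "q < length ys \<and> ys ! q = lev v" if w: "walk_to E a w v" "q \<in> ends w" for w v q
  proof -
    obtain p where "reads ys (map lev w) p q" using w(2) by (auto simp: ends_def)
    from reads_ends(3,5)[OF this] show ?thesis using w(1) by (auto simp: walk_to_def last_map)
  qed
  have step: "\<exists>q'\<in>ends w. adj q' q" if w: "walk_to E a w u" "q \<in> ends (w @ [v])" for w u v q
  proof -
    obtain p where "reads ys (map lev w @ [lev v]) p q" using w(2) by (auto simp: ends_def)
    moreover have "map lev w \<noteq> []" using w(1) by (simp add: walk_to_def)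
    ultimately show ?thesis using reads_snocD by (fastforce simp: ends_def)
  qed
  have lip: "f u \<le> f v + 1" if u: "walk_to E a w u" and e: "E u v" for w u v
  proof -
    obtain w' where w': "walk_to E a w' u" "m w' = f u" using f[OF u] by blast
    note x = walk_to_snoc[OF w'(1) e]
    obtain q where q: "q \<in> ends w'" "adj q (m (w' @ [v]))" using step[OF w'(1) m(1)[OF x]] by blast
    have "f u \<le> q" using m(2)[OF w'(1) q(1)] w'(2) by simp
    moreover have "m (w' @ [v]) \<le> f v" by (rule fge[OF x])
    ultimately show ?thesis using q(2) by (auto simp: adj_def)
  qed
  have val: "f v < length ys \<and> ys ! f v = lev v" if w: "walk_to E a w v" for w v
  proof -
    obtain w' where w': "walk_to E a w' v" "m w' = f v" using f[OF w] by blast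
    show ?thesis using lev[OF w'(1) m(1)[OF w'(1)]] w'(2) by simp
  qed
  show ?thesis
  proof (rule that[of f])
    show "f v < length ys \<and> ys ! f v = lev v" if "walk_to E a w v" for w v by (rule val[OF that])
    show "adj (f u) (f v)" if u: "walk_to E a w u" and e: "E u v" for w u v
    proof -
      note x = walk_to_snoc[OF u e]
      obtain q where q: "q \<in> ends w" "adj q (m (w @ [v]))" using step[OF u m(1)[OF x]] by blast
      have "\<bar>ys ! q - ys ! m (w @ [v])\<bar> = 1"
        using level_list_adj[OF ys _ _ q(2)] lev[OF u q(1)] lev[OF x m(1)[OF x]] by blast
      then have "lev u \<noteq> lev v" using lev[OF u q(1)] lev[OF x m(1)[OF x]] by auto
      then have "f u \<noteq> f v" using val[OF u] val[OF x] by auto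
      moreover have "f u \<le> f v + 1" by (rule lip[OF u e])
      moreover have "f v \<le> f u + 1" by (rule lip[OF x sym[OF e]])
      ultimately show ?thesis by (auto simp: adj_def)
    qed
  qed
qed

subsection \<open>Slow paths that separate\<close>

text \<open>The delayed graph is the product of the path \<^term>\<open>F\<close> with a graph whose vertices \<open>(s, n)\<close> lie
  on two routes \<open>s\<close> of length \<^term>\<open>M\<close>, parallel for \<open>0 < n < M\<close> and identified elsewhere;
  \<^term>\<open>route M s n\<close> is the level of \<open>(s, n)\<close>. Level 0 occurs only at \<open>n = -1\<close> and level \<open>h \<ge> 4\<close>
  only at \<open>n = M + h - 3\<close>, and \<open>n\<close> changes by 1 along every edge.\<close>

definition route :: "int \<Rightarrow> bool \<Rightarrow> int \<Rightarrow> int" where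
  "route M s n = (if n \<le> 0 then n + 1 else if n \<ge> M then n - M + 3 else if odd n then 2 else if s then 3 else 1)"

definition delay_adj :: "int list \<Rightarrow> int \<Rightarrow> nat \<times> bool \<times> int \<Rightarrow> nat \<times> bool \<times> int \<Rightarrow> bool" where
  "delay_adj F M = (\<lambda>(i, s, n) (j, t, m). i < length F \<and> j < length F \<and> adj i j \<and> \<bar>n - m\<bar> = 1 \<and>
     F ! i = route M s n \<and> F ! j = route M t m \<and> (s = t \<or> n \<le> 0 \<or> n \<ge> M \<or> m \<le> 0 \<or> m \<ge> M))"

text \<open>The points shared by both routes: levels up to 1 come before the delay, levels from 3 on
  after it. Level 2 occurs only strictly inside the routes and has no distinguished point, so the
  lemmas on anchors exclude it.\<close>

definition anchor :: "int list \<Rightarrow> int \<Rightarrow> nat \<Rightarrow> nat \<times> bool \<times> int" where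
  "anchor F M j = (j, False, if F ! j \<le> 1 then F ! j - 1 else M + F ! j - 3)"

lemma delay_adj_sym: "delay_adj F M u v \<Longrightarrow> delay_adj F M v u"
  by (auto simp: delay_adj_def adj_def)

text \<open>A position strictly between the two ends is visited by both walks, hence has level 2; as
  neighbours have different levels there is only one such position.\<close>

lemma two_routes_meet:
  assumes ys: "level_list ys" and x: "\<And>n. n \<le> M \<Longrightarrow> x n < length ys" "\<And>n. n < M \<Longrightarrow> adj (x n) (x (Suc n))"
      "\<And>n. n < M \<Longrightarrow> ys ! x n \<in> {1, 2}" 
    and y: "\<And>n. n < M \<Longrightarrow> adj (y n) (y (Suc n))"
      "\<And>n. 0 < n \<Longrightarrow> n \<le> M \<Longrightarrow> ys ! y n \<in> {2, 3}" 
    and e: "x 0 = y 0" "x M = y M" "ys ! x 0 = 1" "ys ! x M = 3"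
  shows "\<exists>b < length ys. adj (x 0) b \<and> adj b (x M) \<and> ys ! b = 2"
proof -
  have two: "ys ! t = 2" if t: "x 0 < t \<and> t < x M \<or> x M < t \<and> t < x 0" for t
  proof -
    have "\<exists>n\<le>M. z n = t" if "z 0 = x 0" "z M = x M" "\<And>n. n < M \<Longrightarrow> adj (z n) (z (Suc n))" for z
    proof (rule ccontr)
      assume "\<not> ?thesis"
      then have "\<forall>n<Suc M. z n \<noteq> t" by auto
      moreover have "\<forall>i. Suc i < Suc M \<longrightarrow> adj (z i) (z (Suc i))" using that by auto
      ultimately consider "\<forall>n<Suc M. z n < t" | "\<forall>n<Suc M. z n > t" using adj_avoid by blast
      then show False using t that(1,2) by (metis lessI less_asym zero_less_Suc)
    qed
    from this[of x] this[of y] obtain n m where n: "n \<le> M" "x n = t" and m: "m \<le> M" "y m = t"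
      using x y e by metis
    have "n \<noteq> M" using t n e by auto
    moreover have "m \<noteq> 0"
    proof
      assume "m = 0"
      then show False using t m e by simp
    qed
    ultimately have "n < M" "0 < m" using n by auto
    then show ?thesis using x(3)[of n] y(2)[of m] n m by auto
  qed
  have b: "x 0 < length ys" "x M < length ys" using x(1) by auto
  have step: "\<bar>ys ! t - ys ! Suc t\<bar> = 1" if "Suc t < length ys" for t
    using level_list_nth[OF ys that] .
  have n1: "x 0 \<noteq> x M" using e by auto
  have n2: "\<not> adj (x 0) (x M)" using level_list_adj[OF ys b] e by auto
  consider "x M = x 0 + 2" | "x 0 = x M + 2" | "x M \<ge> x 0 + 3" | "x 0 \<ge> x M + 3"
    using n1 n2 by (auto simp: adj_def) linarith
  then show ?thesis
  proof cases
    case 1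
    then show ?thesis using two[of "x 0 + 1"] b by (intro exI[of _ "x 0 + 1"]) (auto simp: adj_def)
  next
    case 2
    then show ?thesis using two[of "x M + 1"] b by (intro exI[of _ "x M + 1"]) (auto simp: adj_def)
  next
    case 3
    then show ?thesis using two[of "x 0 + 1"] two[of "x 0 + 2"] step[of "x 0 + 1"] b by auto
  next
    case 4
    then show ?thesis using two[of "x M + 1"] two[of "x M + 2"] step[of "x M + 1"] b by auto
  qed
qed

text \<open>Since \<open>M\<close> is even, \<open>M - 1\<close> is odd, so both routes are at level
  2 right after level 1 at \<open>n = 0\<close> and right before level 3 at
  \<open>n = M\<close>.\<close>

context
  fixes F :: "int list" and h :: int and M :: nat
  assumes F: "peaked h F" and M: "even M" "M \<ge> 2"
begin

abbreviation "E \<equiv> delay_adj F (int M)"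
abbreviation "c \<equiv> anchor F (int M)"
abbreviation "start \<equiv> (0::nat, False, - 1 :: int)"

text \<open>Path duality yields a map on the component of one vertex only, so every point used below
  must be shown to lie in the component of \<open>start\<close>.\<close>

definition reach :: "nat \<times> bool \<times> int \<Rightarrow> bool" where
  "reach v \<longleftrightarrow> (\<exists>w. walk_to E start w v)"

lemma level_bounds: "j < length F \<Longrightarrow> 0 \<le> F ! j \<and> F ! j \<le> h"
proof -
  assume "j < length F"
  then have "F ! j \<in> set F" by simp
  moreover have "set F \<subseteq> {0..h}" using F by (simp add: peaked_def)
  ultimately show ?thesis by auto
qed

lemma level_step: "i < length F \<Longrightarrow> j < length F \<Longrightarrow> adj i j \<Longrightarrow> \<bar>F ! i - F ! j\<bar> = 1"
  by (rule level_list_adj) (use F in \<open>auto simp: peaked_def\<close>)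

lemma reach_step: "reach u \<Longrightarrow> E u v \<Longrightarrow> reach v"
  unfolding reach_def by (elim exE) (rule exI, rule walk_to_snoc)

lemma reach_chain:
  assumes "\<And>n. n < k \<Longrightarrow> E (z n) (z (Suc n))" and "reach (z 0) \<or> reach (z k)" and "n \<le> k"
  shows "reach (z n)"
proof -
  have up: "reach (z 0) \<Longrightarrow> n \<le> k \<Longrightarrow> reach (z n)" for n
  proof (induction n)
    case (Suc n)
    then show ?case using reach_step[OF _ assms(1)[of n]] by simp
  qed simp
  have "reach (z k) \<Longrightarrow> i \<le> k \<Longrightarrow> reach (z (k - i))" for i
  proof (induction i)
    case (Suc i)
    then have "E (z (k - Suc i)) (z (k - i))" using assms(1)[of "k - Suc i"] by (simp add: Suc_diff_Suc)
    moreover have "reach (z (k - i))" using Suc by simp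
    ultimately show ?case using reach_step[OF _ delay_adj_sym] by blast
  qed simp
  from this[of k] have "reach (z 0)" using assms(2) by auto
  then show ?thesis using up assms(3) by blast
qed

text \<open>For neighbouring positions \<open>A\<close>, \<open>B\<close>, \<open>C\<close> at
  levels 1, 2, 3 this walk spends the delay between \<open>A\<close> and \<open>B\<close>, and
  \<open>high\<close> spends it between \<open>B\<close> and \<open>C\<close>.\<close>

definition low :: "nat \<Rightarrow> nat \<Rightarrow> nat \<Rightarrow> nat \<Rightarrow> nat \<times> bool \<times> int" where
  "low A B C n = (if n = M then C else if even n then A else B, False, int n)"

text \<open>The flag is \<open>True\<close> only strictly between the ends. Points that differ in
  the flag are different vertices even where the routes are shared, and the ends must be the very
  anchors at which \<open>low\<close> begins and ends.\<close>

definition high :: "nat \<Rightarrow> nat \<Rightarrow> nat \<Rightarrow> nat \<Rightarrow> nat \<times> bool \<times> int" where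
  "high A B C n = (if n = 0 then A else if even n then C else B, 0 < n \<and> n < M, int n)"

lemma routes_adj:
  assumes "A < length F" "B < length F" "C < length F" "adj A B" "adj B C" "F ! A = 1" "F ! B = 2" "F ! C = 3"
  shows "n < M \<Longrightarrow> E (low A B C n) (low A B C (Suc n))" "n < M \<Longrightarrow> E (high A B C n) (high A B C (Suc n))"
    "low A B C 0 = c A" "high A B C 0 = c A" "low A B C M = c C" "high A B C M = c C"
proof -
  have odd: "Suc n = M \<Longrightarrow> odd n" for n using M by auto
  note sym = adj_sym[OF assms(4)] adj_sym[OF assms(5)]
  show "n < M \<Longrightarrow> E (low A B C n) (low A B C (Suc n))"
    using assms sym M odd[of n] by (auto simp: delay_adj_def low_def route_def)
  show "n < M \<Longrightarrow> E (high A B C n) (high A B C (Suc n))"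
    using assms sym M odd[of n] by (auto simp: delay_adj_def high_def route_def)
  show "low A B C 0 = c A" "high A B C 0 = c A" "low A B C M = c C" "high A B C M = c C"
    using assms M by (auto simp: low_def high_def anchor_def)
qed

lemma anchor_adj:
  assumes "i < length F" "j < length F" "adj i j" "F ! i \<noteq> 2" "F ! j \<noteq> 2"
  shows "E (c i) (c j)"
  using assms level_step[of i j] level_bounds[of i] level_bounds[of j] M
  by (auto simp: delay_adj_def anchor_def route_def)

text \<open>Turns 1, 2, 1 and, in the next lemma, 3, 2, 3 need no delay: the position at level 2 is
  put on a route right next to the anchor from which it is entered, and it is left to the same
  side.\<close>

lemma anchor_low:
  assumes "i < length F" "j < length F" "adj i j" "F ! i = 1" "F ! j = 2"
  shows "E (c i) (j, False, 1)"
  using assms M by (auto simp: delay_adj_def anchor_def route_def)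

lemma anchor_high:
  assumes "i < length F" "j < length F" "adj i j" "F ! i = 3" "F ! j = 2"
  shows "E (c i) (j, False, int M - 1)"
  using assms M by (auto simp: delay_adj_def anchor_def route_def)

text \<open>\<open>F\<close> starts at level 0 and the neighbours of level 2 are at levels 1 and 3,
  so going along \<open>F\<close> from anchor to anchor means advancing by one or two
  positions.\<close>

lemma anchor_induct [consumes 2, case_names zero near far]:
  assumes "j < length F" "F ! j \<noteq> 2"
    and "P 0"
    and near: "\<And>j. Suc j < length F \<Longrightarrow> F ! j \<noteq> 2 \<Longrightarrow> F ! Suc j \<noteq> 2 \<Longrightarrow> P j \<Longrightarrow> P (Suc j)"
    and far: "\<And>j. Suc (Suc j) < length F \<Longrightarrow> F ! j \<in> {1, 3} \<Longrightarrow> F ! Suc j = 2 \<Longrightarrow> F ! Suc (Suc j) \<in> {1, 3}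
       \<Longrightarrow> P j \<Longrightarrow> P (Suc (Suc j))"
  shows "P j"
  using assms(1,2)
proof (induction j rule: less_induct)
  case (less j)
  have F0: "F ! 0 = 0" using peakedD[OF F] by simp
  show ?case
  proof (cases j)
    case 0
    then show ?thesis using assms(3) by simp
  next
    case (Suc i)
    show ?thesis
    proof (cases "F ! i = 2")
      case False
      then show ?thesis using near[of i] less Suc by simp
    next
      case True
      then obtain k where k: "i = Suc k" using F0 by (cases i) auto
      have "F ! k \<in> {1, 3}" using level_step[of k i] True k less Suc by (auto simp: adj_def)
      moreover have "F ! j \<in> {1, 3}" using level_step[of i j] True k less Suc by (auto simp: adj_def)
      ultimately show ?thesis using far[of k] less True k Suc by auto
    qed
  qed
qed

lemma reach_anchor:
  assumes "j < length F" "F ! j \<noteq> 2" shows "reach (c j)"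
  using assms
proof (induction j rule: anchor_induct)
  case zero
  have "c 0 = start" using peakedD[OF F] by (simp add: anchor_def)
  moreover have "walk_to E start [start] start" by (simp add: walk_to_def)
  ultimately show ?case unfolding reach_def by metis
next
  case (near j)
  then have "E (c j) (c (Suc j))" by (intro anchor_adj) (auto simp: adj_def)
  then show ?case using near reach_step by blast
next
  case (far j)
  have a: "adj j (Suc j)" "adj (Suc j) (Suc (Suc j))" "adj (Suc (Suc j)) (Suc j)" "adj (Suc j) j" by (auto simp: adj_def)
  have l: "j < length F" "Suc j < length F" using far by auto
  consider "F ! j = 1" "F ! Suc (Suc j) = 1" | "F ! j = 3" "F ! Suc (Suc j) = 3"
    | "F ! j = 1" "F ! Suc (Suc j) = 3" | "F ! j = 3" "F ! Suc (Suc j) = 1" using far by auto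
  then show ?case
  proof cases
    case 1
    then show ?thesis using anchor_low a l far reach_step delay_adj_sym by metis
  next
    case 2
    then show ?thesis using anchor_high a l far reach_step delay_adj_sym by metis
  next
    case 3
    note g = routes_adj[OF l far(1) a(1,2) 3(1) far(3) 3(2)]
    show ?thesis using reach_chain[where z = "low j (Suc j) (Suc (Suc j))" and k = M and n = M, OF g(1)] far g(3,5) by auto
  next
    case 4
    note g = routes_adj[OF far(1) l(2,1) a(3,4) 4(2) far(3) 4(1)]
    show ?thesis using reach_chain[where z = "low (Suc (Suc j)) (Suc j) j" and k = M and n = 0, OF g(1)] far g(3,5) by auto
  qed
qed

text \<open>If all walks mapped to \<open>W\<close>, path duality would map the whole component of
  \<open>start\<close> by one \<open>f\<close>. Then \<open>F\<close> would map to \<open>W\<close>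
  too: positions off level 2 go to the images of their anchors, a turn at level 2 to the image of
  its point on a route, and a straight passage through level 2 to the position found by
  \<open>two_routes_meet\<close>.\<close>

lemma delayed_walk_escapes:
  assumes W: "level_list W" and no: "\<not> lhom F W"
  shows "\<exists>w v. walk_to E start w v \<and> \<not> lhom (map (\<lambda>(j, _). F ! j) w) W"
proof (rule ccontr)
  assume "\<not> ?thesis"
  then have all: "\<And>w v. walk_to E start w v \<Longrightarrow> lhom (map (\<lambda>(j, _). F ! j) w) W" by blast
  obtain f where f: "\<And>w v. walk_to E start w v \<Longrightarrow> f v < length W \<and> W ! f v = (case v of (j, _) \<Rightarrow> F ! j)"
    "\<And>w u v. walk_to E start w u \<Longrightarrow> E u v \<Longrightarrow> adj (f u) (f v)"
    by (rule path_duality[of E W start "\<lambda>(j, _). F ! j"])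
      (use W all in \<open>auto intro: delay_adj_sym\<close>)
  have fv: "f (j, s) < length W" "W ! f (j, s) = F ! j" if "reach (j, s)" for j s
    using that f(1)[of _ "(j, s)"] by (auto simp: reach_def)
  have fa: "adj (f u) (f v)" if "reach u" "E u v" for u v
    using that(1) f(2)[OF _ that(2)] by (auto simp: reach_def)
  have fc: "f (c j) < length W" "W ! f (c j) = F ! j" if "j < length F" "F ! j \<noteq> 2" for j
    using fv reach_anchor[OF that] by (auto simp: anchor_def)
  have mid: "\<exists>b<length W. adj (f (c A)) b \<and> adj b (f (c C)) \<and> W ! b = 2"
    if g: "A < length F" "B < length F" "C < length F" "adj A B" "adj B C" "F ! A = 1" "F ! B = 2" "F ! C = 3"
    for A B C
  proof -
    note gd = routes_adj[OF g]
    have r: "reach (low A B C n)" "reach (high A B C n)" if "n \<le> M" for n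
      using reach_chain[where z = "low A B C" and k = M and n = n, OF gd(1)]
        reach_chain[where z = "high A B C" and k = M and n = n, OF gd(2)] reach_anchor[of A] g gd that by auto
    have xv: "f (low A B C n) < length W" "W ! f (low A B C n) = F ! fst (low A B C n)"
      "W ! f (high A B C n) = F ! fst (high A B C n)" if "n \<le> M" for n
      using fv[of "fst (low A B C n)" "snd (low A B C n)"] fv[of "fst (high A B C n)" "snd (high A B C n)"] r[OF that]
      by auto
    have "\<exists>b<length W. adj (f (low A B C 0)) b \<and> adj b (f (low A B C M)) \<and> W ! b = 2"
    proof (rule two_routes_meet[OF W, of M _ "\<lambda>n. f (high A B C n)"])
      show "f (low A B C n) < length W" if "n \<le> M" for n using xv that by blast
      show "adj (f (low A B C n)) (f (low A B C (Suc n)))" if "n < M" for n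
        using fa[OF r(1) gd(1)] that by simp
      show "adj (f (high A B C n)) (f (high A B C (Suc n)))" if "n < M" for n
        using fa[OF r(2) gd(2)] that by simp
      show "W ! f (low A B C n) \<in> {1, 2}" if "n < M" for n
        using xv(2)[of n] that g by (auto simp: low_def)
      show "W ! f (high A B C n) \<in> {2, 3}" if "0 < n" "n \<le> M" for n
        using xv(3)[of n] that g by (auto simp: high_def)
      show "f (low A B C 0) = f (high A B C 0)" "f (low A B C M) = f (high A B C M)" using gd by auto
      show "W ! f (low A B C 0) = 1" "W ! f (low A B C M) = 3"
        using xv(2)[of 0] xv(2)[of M] g M by (auto simp: low_def)
    qed
    then show ?thesis using gd by simp
  qed
  \<comment> \<open>The map of \<open>F\<close> is built along its prefixes; fixing the end at
    \<open>f (c j)\<close> makes the pieces fit.\<close>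
  have rd: "\<exists>p. reads W (take (Suc j) F) p (f (c j))" if "j < length F" "F ! j \<noteq> 2" for j
    using that
  proof (induction j rule: anchor_induct)
    case zero
    have "0 < length F" "F ! 0 \<noteq> 2" using peakedD[OF F] by auto
    then show ?case using reads_single[OF fc(1)[of 0]] fc(2)[of 0] by (auto simp: take_Suc_conv_app_nth)
  next
    case (near j)
    then have "E (c j) (c (Suc j))" by (intro anchor_adj) (auto simp: adj_def)
    then have "adj (f (c j)) (f (c (Suc j)))" using fa reach_anchor near by simp
    then show ?case using near fc[of "Suc j"] reads_snoc
      by (metis take_Suc_conv_app_nth)
  next
    case (far j)
    have a: "adj j (Suc j)" "adj (Suc j) (Suc (Suc j))" "adj (Suc (Suc j)) (Suc j)" "adj (Suc j) j"
      by (auto simp: adj_def)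
    have l: "j < length F" "Suc j < length F" using far by auto
    have n: "F ! j \<noteq> 2" "F ! Suc (Suc j) \<noteq> 2" using far by auto
    have "\<exists>b<length W. adj (f (c j)) b \<and> adj b (f (c (Suc (Suc j)))) \<and> W ! b = 2"
    proof -
      have side: ?thesis if e: "E (c j) (Suc j, s)" "E (c (Suc (Suc j))) (Suc j, s)" for s
      proof -
        have "reach (Suc j, s)" using reach_step[OF reach_anchor[OF l(1) n(1)] e(1)] .
        then show ?thesis
          using fv fa[OF reach_anchor[OF l(1) n(1)] e(1)] fa[OF _ delay_adj_sym[OF e(2)]] far(3) by metis
      qed
      consider "F ! j = 1" "F ! Suc (Suc j) = 1" | "F ! j = 3" "F ! Suc (Suc j) = 3"
        | "F ! j = 1" "F ! Suc (Suc j) = 3" | "F ! j = 3" "F ! Suc (Suc j) = 1" using far by auto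
      then show ?thesis
      proof cases
        case 1
        then show ?thesis using side anchor_low a l far by metis
      next
        case 2
        then show ?thesis using side anchor_high a l far by metis
      next
        case 3
        show ?thesis by (rule mid[OF l far(1) a(1,2) 3(1) far(3) 3(2)])
      next
        case 4
        show ?thesis using mid[OF far(1) l(2,1) a(3,4) 4(2) far(3) 4(1)] adj_sym by blast
      qed
    qed
    then obtain b where b: "b < length W" "adj (f (c j)) b" "adj b (f (c (Suc (Suc j))))" "W ! b = 2" by blast
    obtain p where "reads W (take (Suc j) F) p (f (c j))" using far by blast
    from reads_snoc[OF reads_snoc[OF this b(2,1)] b(3)] fc[OF far(1) n(2)] b(4) far
    show ?case by (auto simp: take_Suc_conv_app_nth)
  qed
  have "F \<noteq> []" "F ! (length F - 1) = 0" using peakedD[OF F] by auto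
  then have "lhom F W" using rd[of "length F - 1"] lhomI by fastforce
  then show False using no by simp
qed

lemma delayed_walk_vertex:
  assumes "walk_to E start w v" "x \<in> set w"
  shows "fst x < length F" "F ! fst x = route (int M) (fst (snd x)) (snd (snd x))"
proof -
  obtain i where i: "i < length w" "x = w ! i" using assms(2) by (auto simp: in_set_conv_nth)
  have "fst x < length F \<and> F ! fst x = route (int M) (fst (snd x)) (snd (snd x))"
  proof (cases i)
    case 0
    then have "x = start" using assms(1) i by (auto simp: walk_to_def hd_conv_nth)
    then show ?thesis using peakedD[OF F] by (simp add: route_def)
  next
    case (Suc k)
    then have "E (w ! k) x" using assms(1) i successively_nth[of E w k] by (auto simp: walk_to_def)
    then show ?thesis by (auto simp: delay_adj_def split: prod.splits)
  qed
  then show "fst x < length F" "F ! fst x = route (int M) (fst (snd x)) (snd (snd x))" by auto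
qed

lemma delayed_walk_reads:
  assumes "walk_to E start w v" shows "reads F (map (\<lambda>(j, _). F ! j) w) 0 (fst v)"
proof -
  have w: "w \<noteq> []" "hd w = start" "last w = v" "successively E w" using assms by (auto simp: walk_to_def)
  have "successively (\<lambda>x y. adj (fst x) (fst y)) w"
    by (rule successively_mono[OF w(4)]) (auto simp: delay_adj_def)
  then have "walk F (map fst w)"
    using w(1) delayed_walk_vertex(1)[OF assms] by (auto simp: walk_def successively_map)
  from readsI[OF this] w show ?thesis by (simp add: hd_map last_map o_def case_prod_unfold)
qed

lemma delayed_walk_slow:
  assumes w: "walk_to E start w v" and h: "h \<ge> 4" and K: "K \<le> M"
  shows "slow h K (map (\<lambda>(j, _). F ! j) w)"
  unfolding slow_def
proof (intro allI impI)
  define g where "g i = snd (snd (w ! i))" for i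
  fix i j
  assume ij: "i < length (map (\<lambda>(j, _). F ! j) w)" "j < length (map (\<lambda>(j, _). F ! j) w)"
    "map (\<lambda>(j, _). F ! j) w ! i = 0" "map (\<lambda>(j, _). F ! j) w ! j = h"
  have "successively E w" using w by (simp add: walk_to_def)
  then have "\<bar>g i - g (Suc i)\<bar> \<le> 1" if "Suc i < length w" for i
    using successively_nth[of E w i] that by (auto simp: delay_adj_def g_def split: prod.splits)
  then have "\<bar>g i - g j\<bar> \<le> \<bar>int i - int j\<bar>" using ij by (intro int_lipschitz[of "length w"]) auto
  moreover have "route (int M) (fst (snd (w ! i))) (g i) = 0" "route (int M) (fst (snd (w ! j))) (g j) = h"
    using delayed_walk_vertex(2)[OF w, of "w ! i"] delayed_walk_vertex(2)[OF w, of "w ! j"] ij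
    by (auto simp: g_def case_prod_unfold)
  then have "g i = -1" "g j = int M + h - 3"
    using h by (auto simp: route_def split: if_splits)
  ultimately show "int K \<le> \<bar>int i - int j\<bar>" using h K by linarith
qed

lemma walk_to_return:
  assumes "walk_to E a w v" shows "walk_to E a (w \<diamondop> rev w) a"
proof -
  have w: "w \<noteq> []" "hd w = a" "successively E w" using assms by (auto simp: walk_to_def)
  have "successively E (rev w)" using successively_mono[OF w(3)] delay_adj_sym by auto
  then show ?thesis using w
    by (auto simp: walk_to_def fuse_nonempty hd_fuse last_fuse hd_rev last_rev intro: successively_fuse)
qed

lemma walk_to_fuse: "walk_to E a w b \<Longrightarrow> walk_to E b w' d \<Longrightarrow> walk_to E a (w \<diamondop> w') d"
  by (auto simp: walk_to_def fuse_nonempty hd_fuse last_fuse intro: successively_fuse)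

text \<open>The escaping walk is closed up by walking it back, then followed by a trip to the top
  and back. The result is still a walk of the delayed graph, hence below \<open>F\<close> and slow,
  and it begins with the escaping walk, hence does not map to \<open>W\<close>.\<close>

lemma slow_escape_delay:
  assumes h: "h \<ge> 4" and K: "K \<le> M" and W: "level_list W" and no: "\<not> lhom F W"
  shows "\<exists>Q. peaked h Q \<and> lhom Q F \<and> \<not> lhom Q W \<and> slow h K Q"
proof -
  define lv where "lv = (\<lambda>(j, _ :: bool \<times> int). F ! j)"
  obtain w v where w: "walk_to E start w v" "\<not> lhom (map lv w) W"
    using delayed_walk_escapes[OF W no] by (auto simp: lv_def)
  obtain t where t: "t < length F" "F ! t = h" using peakedD[OF F] by blast
  obtain w' where w': "walk_to E start w' (c t)" using reach_anchor[of t] t h by (auto simp: reach_def)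
  define u where "u = (w \<diamondop> rev w) \<diamondop> (w' \<diamondop> rev w')"
  have u: "walk_to E start u start"
    unfolding u_def by (rule walk_to_fuse[OF walk_to_return[OF w(1)] walk_to_return[OF w']])
  define Q where "Q = map lv u"
  have r: "reads F Q 0 0" using delayed_walk_reads[OF u] by (simp add: Q_def lv_def)
  have ne: "w \<noteq> []" "w' \<noteq> []" "hd w = start" "hd w' = start" "last w' = c t"
    using w w' by (auto simp: walk_to_def)
  have "c t \<in> set w'" using ne last_in_set by metis
  then have "c t \<in> set u"
    using ne unfolding u_def by (simp add: set_fuse fuse_nonempty hd_fuse last_fuse hd_rev last_rev)
  then have "h \<in> set Q" using t unfolding Q_def lv_def anchor_def by force
  moreover have "level_list Q" "set Q \<subseteq> {0..h}" "hd Q = 0" "last Q = 0"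
    using reads_level_list[OF _ r] reads_ends[OF r] F peakedD[OF F] by (auto simp: peaked_def)
  ultimately have "peaked h Q" by (simp add: peaked_def)
  moreover have "lhom Q F" using r by (rule lhomI)
  moreover have "slow h K Q" using delayed_walk_slow[OF u h K] by (simp add: Q_def lv_def)
  moreover have "lhom (map lv w) Q"
  proof -
    have "Q = map lv w \<diamondop> map lv (rev w \<diamondop> (w' \<diamondop> rev w'))"
      using ne by (simp add: Q_def u_def fuse_def map_tl)
    then show ?thesis using lhom_fuse_left[of "map lv w"] ne by simp
  qed
  ultimately show ?thesis using w(2) lhom_trans by blast
qed

end

lemma slow_escape:
  assumes "peaked h F" "h \<ge> 4" "level_list W" "\<not> lhom F W"
  shows "\<exists>Q. peaked h Q \<and> lhom Q F \<and> \<not> lhom Q W \<and> slow h K Q"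
  \<comment> \<open>\<open>2 * K + 2\<close> is even, at least 2 and at least
    \<open>K\<close>.\<close>
  using slow_escape_delay[OF assms(1), of "2 * K + 2" K W] assms by simp


subsection \<open>Embedding a countable preorder\<close>

text \<open>\<open>F j\<close> separates \<open>W j\<close> from the \<open>W i\<close> with \<open>i\<close> not below \<open>j\<close>. The \<open>F j\<close> change from stage to
  stage, the \<open>W j\<close> do not.\<close>

definition realized :: "int \<Rightarrow> int list \<Rightarrow> int list \<Rightarrow> (nat \<Rightarrow> nat \<Rightarrow> bool) \<Rightarrow> nat \<Rightarrow> (nat \<Rightarrow> int list) \<times> (nat \<Rightarrow> int list) \<Rightarrow> bool" where
  "realized h P1 P2 le n = (\<lambda>(W, F).
     (\<forall>i\<le>n. peaked h (W i) \<and> lhom P1 (W i) \<and> lhom (W i) P2) \<and>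
     (\<forall>i\<le>n. peaked h (F i) \<and> lhom (F i) P2 \<and> \<not> lhom (F i) (W i)) \<and>
     (\<forall>i\<le>n. \<forall>j\<le>n. if le i j then lhom (W i) (W j) else lhom (F j) (W i)))"

lemma realized_extend:
  assumes P2: "peaked h P2" and h: "h \<ge> 4"
    and refl: "\<And>i. le i i" and trans: "\<And>i j k. le i j \<Longrightarrow> le j k \<Longrightarrow> le i k" and bot: "\<And>i. le 0 i"
    and inv: "realized h P1 P2 le n (W, F)"
  shows "\<exists>W' F'. realized h P1 P2 le (Suc n) (W', F') \<and> (\<forall>i\<le>n. W' i = W i)"
proof -
  define m where "m = Suc n"
  define D where "D = {d. d \<le> n \<and> le d m}"
  define U where "U = {u. u \<le> n \<and> le m u}"
  have W: "peaked h (W i)" "lhom P1 (W i)" "lhom (W i) P2" if "i \<le> n" for i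
    using inv that by (auto simp: realized_def)
  have F: "peaked h (F i)" "lhom (F i) P2" "\<not> lhom (F i) (W i)" if "i \<le> n" for i
    using inv that by (auto simp: realized_def)
  have WW: "lhom (W i) (W j)" if "i \<le> n" "j \<le> n" "le i j" for i j
    using inv that by (auto simp: realized_def)
  have FW: "lhom (F j) (W i)" if "i \<le> n" "j \<le> n" "\<not> le i j" for i j
    using inv that by (auto simp: realized_def)
  define T where "T = insert P2 (W ` {..n})"
  have T: "finite T" "\<And>X. X \<in> T \<Longrightarrow> peaked h X" using W P2 by (auto simp: T_def)
  \<comment> \<open>The least element makes \<open>D\<close> nonempty, as the joins require, and
    later places the new path above \<open>P1\<close>.\<close>
  have D: "finite D" "D \<noteq> {}" "0 \<in> D" using bot by (auto simp: D_def)
  have h3: "h \<ge> 3" using h by simp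
  \<comment> \<open>The new separating path lies above each \<open>F d\<close> with \<open>d\<close>
    below \<open>m\<close>, so it is rejected by these \<open>W d\<close>. An \<open>i\<close> not
    below \<open>m\<close> is below no such \<open>d\<close>, so all these \<open>F d\<close> map to
    \<open>W i\<close>, and so does their join.\<close>
  obtain Fm where Fm: "peaked h Fm" "\<forall>A\<in>F ` D. lhom A Fm" "\<forall>X\<in>T. (\<forall>A\<in>F ` D. lhom A X) \<longrightarrow> lhom Fm X"
    using join_exists[of "F ` D" h T 0, OF _ _ _ T h3] D F by (auto simp: D_def)
  have FmD: "\<not> lhom Fm (W d)" if "d \<in> D" for d
    using Fm(2) F(3)[of d] that lhom_trans by (auto simp: D_def)
  have Fm2: "lhom Fm P2" using Fm(3) F(2) by (auto simp: T_def D_def)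
  have FmW: "lhom Fm (W i)" if i: "i \<le> n" "\<not> le i m" for i
  proof -
    have "lhom (F d) (W i)" if "d \<in> D" for d
      using FW[of i d] that i trans[of i d m] by (auto simp: D_def)
    then show ?thesis using Fm(3) i by (auto simp: T_def)
  qed
  \<comment> \<open>The slowness is the length of \<open>Fm\<close>, so that \<open>Fm\<close>
    itself cannot map to any of these paths.\<close>
  have "\<exists>Q. peaked h Q \<and> lhom Q (F j) \<and> \<not> lhom Q (W j) \<and> slow h (length Fm) Q" if "j \<le> n" for j
    using slow_escape[OF F(1)[OF that] h _ F(3)[OF that]] W(1)[OF that] by (simp add: peaked_def)
  then obtain Q where Q: "\<And>j. j \<le> n \<Longrightarrow> peaked h (Q j) \<and> lhom (Q j) (F j) \<and> \<not> lhom (Q j) (W j) \<and>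
      slow h (length Fm) (Q j)" by metis
  \<comment> \<open>The new path must lie above \<open>W d\<close> for \<open>d\<close> below
    \<open>m\<close>. For each \<open>j\<close> not above \<open>m\<close> it must also receive a
    path rejected by \<open>W j\<close>.\<close>
  define S where "S = W ` D \<union> Q ` ({..n} - U)"
  have S: "finite S" "S \<noteq> {}" "\<And>A. A \<in> S \<Longrightarrow> peaked h A"
    using D W Q by (auto simp: S_def D_def)
  obtain Wm where Wm: "peaked h Wm" "\<forall>A\<in>S. lhom A Wm" "\<forall>X\<in>T. (\<forall>A\<in>S. lhom A X) \<longrightarrow> lhom Wm X"
    "\<forall>G. 0 \<in> set G \<longrightarrow> length G \<le> length Fm \<longrightarrow> lhom G Wm \<longrightarrow> (\<exists>A\<in>S. lhom G A)"
    using join_exists[of S h T "length Fm", OF S T h3] by blast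
  have Qless: "lhom (Q j) X" if "j \<le> n" "lhom (F j) X" for j X
    using Q[OF that(1)] that(2) lhom_trans by blast
  have WmU: "lhom Wm (W u)" if u: "u \<in> U" for u
  proof -
    have "lhom (W d) (W u)" if "d \<in> D" for d
      using WW[of d u] u that trans[of d m u] by (auto simp: D_def U_def)
    moreover have "lhom (Q j) (W u)" if "j \<in> {..n} - U" for j
    proof -
      have "\<not> le u j" using that u trans[of m u j] by (auto simp: U_def)
      then show ?thesis using Qless FW[of u j] that u by (auto simp: U_def)
    qed
    ultimately have "\<forall>A\<in>S. lhom A (W u)" by (auto simp: S_def)
    moreover have "W u \<in> T" using u by (auto simp: T_def U_def)
    ultimately show ?thesis using Wm(3) by blast
  qed
  have Wm2: "lhom Wm P2"
  proof -
    have "lhom A P2" if "A \<in> S" for A using that W Qless F(2) by (auto simp: S_def D_def)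
    then show ?thesis using Wm(3) by (auto simp: T_def)
  qed
  have "lhom P1 (W 0)" "lhom (W 0) Wm" using W(2)[of 0] Wm(2) D by (auto simp: S_def)
  then have Wm1: "lhom P1 Wm" using lhom_trans by blast
  \<comment> \<open>\<open>Fm\<close> is short enough to be join-prime here, so it would map to a
    piece: some \<open>W d\<close>, which rejects it, or some \<open>Q j\<close>, which is too
    slow.\<close>
  have FmWm: "\<not> lhom Fm Wm"
  proof
    assume "lhom Fm Wm"
    then obtain A where A: "A \<in> S" "lhom Fm A" using Wm(4) peakedD(5)[OF Fm(1)] by blast
    then consider d where "d \<in> D" "A = W d" | j where "j \<le> n" "A = Q j" by (auto simp: S_def)
    then show False
    proof cases
      case 1
      then show ?thesis using FmD A by blast
    next
      case 2
      then have "slow h (length Fm) Fm" using lhom_slow[OF A(2)] Q by blast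
      then show ?thesis using slow_long[OF Fm(1)] by blast
    qed
  qed
  define W' where "W' = W(m := Wm)"
  \<comment> \<open>Passing from \<open>F j\<close> to the smaller \<open>Q j\<close> loses nothing:
    it maps wherever \<open>F j\<close> did, and \<open>W j\<close> still rejects it.\<close>
  define F' where "F' = (\<lambda>j. if j = m then Fm else if j \<in> U then F j else Q j)"
  have W': "W' i = W i" if "i \<le> n" for i using that by (simp add: W'_def m_def)
  have le: "if le i j then lhom (W' i) (W' j) else lhom (F' j) (W' i)" if ij: "i \<le> Suc n" "j \<le> Suc n" for i j
  proof -
    consider "i \<le> n" "j \<le> n" | "i = m" "j \<le> n" | "i \<le> n" "j = m" | "i = m" "j = m"
      using ij by (auto simp: m_def le_Suc_eq)
    then show ?thesis
    proof cases
      case 1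
      then show ?thesis using WW[of i j] FW[of i j] Qless[of j "W i"] by (auto simp: W' F'_def m_def)
    next
      case 2
      then have "le m j \<longleftrightarrow> j \<in> U" by (simp add: U_def)
      moreover have "j \<noteq> m" using 2 by (simp add: m_def)
      ultimately show ?thesis using 2 WmU Wm(2) by (auto simp: W' F'_def S_def) (auto simp: W'_def)
    next
      case 3
      then have "le i m \<longleftrightarrow> i \<in> D" by (simp add: D_def)
      then show ?thesis using 3 Wm(2) FmW by (auto simp: W' F'_def S_def) (auto simp: W'_def)
    next
      case 4
      then show ?thesis using refl lhom_refl peakedD(1)[OF Wm(1)] by (simp add: W'_def)
    qed
  qed
  have "peaked h (W' i) \<and> lhom P1 (W' i) \<and> lhom (W' i) P2" if "i \<le> Suc n" for i
    using that W Wm(1) Wm1 Wm2 by (cases "i = m") (auto simp: W'_def m_def le_Suc_eq)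
  moreover have "peaked h (F' i) \<and> lhom (F' i) P2 \<and> \<not> lhom (F' i) (W' i)" if "i \<le> Suc n" for i
    using that F Q Qless Fm(1) Fm2 FmWm by (cases "i = m") (auto simp: W'_def F'_def m_def le_Suc_eq)
  ultimately have "realized h P1 P2 le (Suc n) (W', F')" using le by (simp add: realized_def)
  then show ?thesis using W' by blast
qed

lemma preorder_realized:
  fixes le :: "nat \<Rightarrow> nat \<Rightarrow> bool"
  assumes P: "peaked h P1" "peaked h P2" "lhom P1 P2" "\<not> lhom P2 P1" and h: "h \<ge> 4"
    and refl: "\<And>i. le i i" and trans: "\<And>i j k. le i j \<Longrightarrow> le j k \<Longrightarrow> le i k" and bot: "\<And>i. le 0 i"
  shows "\<exists>W. (\<forall>i. peaked h (W i) \<and> lhom P1 (W i) \<and> lhom (W i) P2) \<and> (\<forall>i j. lhom (W i) (W j) \<longleftrightarrow> le i j)"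
proof -
  have "\<exists>s. \<forall>n. realized h P1 P2 le n (s n) \<and> (\<forall>i\<le>n. fst (s (Suc n)) i = fst (s n) i)"
  proof (rule dependent_nat_choice)
    \<comment> \<open>\<open>P2\<close> does not map to \<open>P1\<close>, so it is the separating
      path of the least element.\<close>
    have "realized h P1 P2 le 0 (\<lambda>_. P1, \<lambda>_. P2)"
      using P refl lhom_refl peakedD(1) by (auto simp: realized_def)
    then show "\<exists>s. realized h P1 P2 le 0 s" ..
  next
    fix s n assume s: "realized h P1 P2 le n s"
    obtain W F where "s = (W, F)" by fastforce
    moreover have "\<exists>W' F'. realized h P1 P2 le (Suc n) (W', F') \<and> (\<forall>i\<le>n. W' i = W i)"
      by (rule realized_extend[where F = F]) (use P(2) h refl trans bot s \<open>s = (W, F)\<close> in auto)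
    ultimately show "\<exists>s'. realized h P1 P2 le (Suc n) s' \<and> (\<forall>i\<le>n. fst s' i = fst s i)" by force
  qed
  then obtain s where s: "\<And>n. realized h P1 P2 le n (s n)" "\<And>n i. i \<le> n \<Longrightarrow> fst (s (Suc n)) i = fst (s n) i"
    by blast
  define W where "W i = fst (s i) i" for i
  have W: "fst (s n) i = W i" if "i \<le> n" for i n
    using that by (induction n rule: dec_induct) (auto simp: W_def s(2))
  have "peaked h (W i) \<and> lhom P1 (W i) \<and> lhom (W i) P2" for i
    using s(1)[of i] by (auto simp: realized_def W_def split: prod.splits)
  moreover have "lhom (W i) (W j) \<longleftrightarrow> le i j" for i j
  proof -
    define n where "n = max i j"
    obtain V F where VF: "s n = (V, F)" by fastforce
    have v: "V i = W i" "V j = W j" using W[of i n] W[of j n] VF by (auto simp: n_def)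
    have "if le i j then lhom (V i) (V j) else lhom (F j) (V i)" "\<not> lhom (F j) (V j)"
      using s(1)[of n] VF by (auto simp: realized_def n_def)
    \<comment> \<open>If \<open>i\<close> is not below \<open>j\<close>, a homomorphism from
      \<open>W i\<close> to \<open>W j\<close> would carry \<open>F j\<close> into
      \<open>W j\<close>.\<close>
    then show ?thesis using v lhom_trans[of "F j" "W i" "W j"] by (auto split: if_splits)
  qed
  ultimately show ?thesis by blast
qed


subsection \<open>Digraphs of level lists\<close>

definition list_digraph :: "int list \<Rightarrow> nat digraph" where
  "list_digraph xs = ({..<length xs},
     {(i, j). i < length xs \<and> j < length xs \<and> adj i j \<and> xs ! j = xs ! i + 1})"

lemma hom_trans:
  assumes "hom G H" "hom H K" shows "hom G K"
proof -
  obtain f where f: "f ` fst G \<subseteq> fst H" "\<forall>u v. (u, v) \<in> snd G \<longrightarrow> (f u, f v) \<in> snd H"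
    using assms(1) unfolding hom_def by (elim exE conjE)
  obtain g where g: "g ` fst H \<subseteq> fst K" "\<forall>u v. (u, v) \<in> snd H \<longrightarrow> (g u, g v) \<in> snd K"
    using assms(2) unfolding hom_def by (elim exE conjE)
  have "(g \<circ> f) ` fst G \<subseteq> fst K" using f(1) g(1) by (auto simp: image_subset_iff)
  moreover have "\<forall>u v. (u, v) \<in> snd G \<longrightarrow> ((g \<circ> f) u, (g \<circ> f) v) \<in> snd K" using f(2) g(2) by simp
  ultimately show ?thesis unfolding hom_def by blast
qed

lemma oriented_path_list_digraph:
  assumes xs: "level_list xs" shows "oriented_path (list_digraph xs)"
  unfolding oriented_path_def
proof (intro exI[of _ "length xs - 1"] exI[of _ id] conjI ballI)
  have ne: "xs \<noteq> []" using xs by (simp add: level_list_def)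
  then show "bij_betw id {0..length xs - 1} (fst (list_digraph xs))"
    by (cases xs) (auto simp: list_digraph_def bij_betw_def)
  fix i assume i: "i \<in> {1..length xs - 1}"
  then have "\<bar>xs ! (i - 1) - xs ! i\<bar> = 1" using level_list_nth[OF xs, of "i - 1"] by auto
  then show "((id (i - 1), id i) \<in> snd (list_digraph xs)) = ((id i, id (i - 1)) \<notin> snd (list_digraph xs))"
    using i by (auto simp: list_digraph_def adj_def)
next
  show "snd (list_digraph xs) \<subseteq> {(id (i - 1), id i) |i. i \<in> {1..length xs - 1}} \<union>
      {(id i, id (i - 1)) |i. i \<in> {1..length xs - 1}}"
  proof
    fix a assume "a \<in> snd (list_digraph xs)"
    then obtain i j where "a = (i, j)" "i < length xs" "j < length xs" "i = Suc j \<or> j = Suc i"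
      by (auto simp: list_digraph_def adj_def)
    then show "a \<in> {(id (i - 1), id i) |i. i \<in> {1..length xs - 1}} \<union>
      {(id i, id (i - 1)) |i. i \<in> {1..length xs - 1}}" by force
  qed
qed

lemma oriented_path_levels:
  assumes "oriented_path G"
  obtains xs where "level_list xs" "hom G (list_digraph xs)" "hom (list_digraph xs) G"
proof -
  obtain n :: nat and p :: "nat \<Rightarrow> nat" where p: "bij_betw p {0..n} (fst G)"
    and or: "\<forall>i\<in>{1..n}. ((p (i - 1), p i) \<in> snd G \<longleftrightarrow> (p i, p (i - 1)) \<notin> snd G)"
    and sub: "snd G \<subseteq> {(p (i - 1), p i) | i. i \<in> {1..n}} \<union> {(p i, p (i - 1)) | i. i \<in> {1..n}}"
    using assms unfolding oriented_path_def by blast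
  define l where "l = rec_nat 0 (\<lambda>i x. x + (if (p i, p (Suc i)) \<in> snd G then 1 else - 1 :: int))"
  have l: "l (Suc i) = l i + (if (p i, p (Suc i)) \<in> snd G then 1 else - 1)" for i
    by (simp add: l_def)
  define xs where "xs = map l [0..<Suc n]"
  have len: "length xs = Suc n" and nth: "\<And>i. i \<le> n \<Longrightarrow> xs ! i = l i"
    by (auto simp: xs_def simp del: upt_Suc)
  have arc: "(p i, p (Suc i)) \<in> snd G \<longleftrightarrow> (p (Suc i), p i) \<notin> snd G" if "i < n" for i
    using or that by (auto dest: bspec[of _ _ "Suc i"])
  have "level_list xs" unfolding level_list_def successively_conv_nth
    using len nth l by (auto simp flip: length_greater_0_conv)
  moreover have "hom (list_digraph xs) G" unfolding hom_def
  proof (intro exI[of _ p] conjI allI impI)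
    show "p ` fst (list_digraph xs) \<subseteq> fst G"
      using p len by (auto simp: list_digraph_def bij_betw_def)
    fix u v assume "(u, v) \<in> snd (list_digraph xs)"
    then have uv: "u \<le> n" "v \<le> n" "u = Suc v \<or> v = Suc u" "l v = l u + 1"
      using len nth by (auto simp: list_digraph_def adj_def)
    then show "(p u, p v) \<in> snd G" using l arc by (auto split: if_splits)
  qed
  moreover have "hom G (list_digraph xs)" unfolding hom_def
  proof (intro exI[of _ "inv_into {0..n} p"] conjI allI impI)
    have inv: "inv_into {0..n} p (p i) = i" if "i \<le> n" for i
      using p that by (auto simp: bij_betw_def inv_into_f_f)
    show "inv_into {0..n} p ` fst G \<subseteq> fst (list_digraph xs)"
    proof
      fix x assume "x \<in> inv_into {0..n} p ` fst G"
      moreover have "fst G = p ` {0..n}" using p by (simp add: bij_betw_def)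
      ultimately obtain i where "i \<le> n" "x = inv_into {0..n} p (p i)" by auto
      then show "x \<in> fst (list_digraph xs)" using inv len by (simp add: list_digraph_def)
    qed
    fix u v assume uv: "(u, v) \<in> snd G"
    then have "(\<exists>i\<in>{1..n}. u = p (i - 1) \<and> v = p i) \<or> (\<exists>i\<in>{1..n}. u = p i \<and> v = p (i - 1))"
      using sub by blast
    then obtain i where i: "i < n" "(u = p i \<and> v = p (Suc i)) \<or> (u = p (Suc i) \<and> v = p i)"
      by (metis Suc_diff_1 Suc_le_lessD atLeastAtMost_iff less_eq_Suc_le One_nat_def)
    then show "(inv_into {0..n} p u, inv_into {0..n} p v) \<in> snd (list_digraph xs)"
      using uv inv[of i] inv[of "Suc i"] l[of i] arc[of i] nth[of i] nth[of "Suc i"] len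
      by (auto simp: list_digraph_def adj_def)
  qed
  ultimately show ?thesis using that by blast
qed

lemma list_digraph_shift: "list_digraph (map (\<lambda>x. x + k) xs) = list_digraph xs"
  by (auto simp: list_digraph_def)

lemma level_list_shift: "level_list (map (\<lambda>x. x + k) xs) \<longleftrightarrow> level_list xs"
  by (simp add: level_list_def successively_map)

lemma lhom_imp_hom:
  assumes "lhom xs ys" shows "hom (list_digraph xs) (list_digraph ys)"
proof -
  obtain f where f: "\<forall>i<length xs. f i < length ys \<and> ys ! f i = xs ! i"
    "\<forall>i. Suc i < length xs \<longrightarrow> adj (f i) (f (Suc i))" using assms unfolding lhom_iff_map by blast
  show ?thesis unfolding hom_def list_digraph_def
    using f by (intro exI[of _ f]) (auto simp: adj_def)
qed

text \<open>Every edge keeps its level difference, and a path is connected, so all levels are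
  shifted by the same constant.\<close>

lemma hom_imp_lhom_shift:
  assumes xs: "level_list xs" and hom: "hom (list_digraph xs) (list_digraph ys)"
  obtains k where "lhom (map (\<lambda>x. x + k) xs) ys"
proof -
  obtain f where f: "\<And>i. i < length xs \<Longrightarrow> f i < length ys"
    "\<And>u v. u < length xs \<Longrightarrow> v < length xs \<Longrightarrow> adj u v \<Longrightarrow> xs ! v = xs ! u + 1
      \<Longrightarrow> adj (f u) (f v) \<and> ys ! f v = ys ! f u + 1"
    using hom unfolding hom_def list_digraph_def by auto
  define k where "k = ys ! f 0 - xs ! 0"
  have step: "adj (f i) (f (Suc i)) \<and> ys ! f (Suc i) - ys ! f i = xs ! Suc i - xs ! i"
    if i: "Suc i < length xs" for i
  proof -
    have "xs ! Suc i = xs ! i + 1 \<or> xs ! i = xs ! Suc i + 1" using level_list_nth[OF xs i] by linarith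
    then show ?thesis using f(2)[of i "Suc i"] f(2)[of "Suc i" i] i by (auto simp: adj_def)
  qed
  have "i < length xs \<Longrightarrow> ys ! f i = xs ! i + k" for i
  proof (induction i)
    case (Suc i)
    then show ?case using step[of i] by simp
  qed (simp add: k_def)
  then have "lhom (map (\<lambda>x. x + k) xs) ys" unfolding lhom_iff_map
    using f(1) step xs by (intro conjI exI[of _ f]) (auto simp: level_list_def)
  then show ?thesis by (rule that)
qed

lemma lhom_set: "lhom xs ys \<Longrightarrow> set xs \<subseteq> set ys"
  using reads_ends(6) unfolding lhom_def by blast

text \<open>Normalised levels: between two lists that span the same range the only possible shift is
  0, so \<open>hom\<close> and \<open>lhom\<close> agree.\<close>

definition spans :: "int \<Rightarrow> int list \<Rightarrow> bool" where
  "spans h xs \<longleftrightarrow> level_list xs \<and> set xs \<subseteq> {0..h} \<and> 0 \<in> set xs \<and> h \<in> set xs"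

lemma peaked_spans: "peaked h xs \<Longrightarrow> spans h xs"
  using peakedD(5)[of h xs] by (simp add: peaked_def spans_def)

lemma hom_iff_lhom:
  assumes "spans h xs" "spans h ys"
  shows "hom (list_digraph xs) (list_digraph ys) \<longleftrightarrow> lhom xs ys"
proof
  assume "hom (list_digraph xs) (list_digraph ys)"
  then obtain k where k: "lhom (map (\<lambda>x. x + k) xs) ys"
    using hom_imp_lhom_shift assms by (metis spans_def)
  then have "set (map (\<lambda>x. x + k) xs) \<subseteq> {0..h}" using lhom_set assms by (fastforce simp: spans_def)
  moreover have "0 + k \<in> set (map (\<lambda>x. x + k) xs)" "h + k \<in> set (map (\<lambda>x. x + k) xs)"
    using assms by (auto simp: spans_def)
  ultimately have "0 + k \<in> {0..h}" "h + k \<in> {0..h}" by blast+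
  then have "k = 0" by simp
  then show "lhom xs ys" using k by simp
qed (rule lhom_imp_hom)

lemma hom_spans_le:
  assumes xs: "spans h xs" and ys: "spans k ys" and hom: "hom (list_digraph xs) (list_digraph ys)"
  shows "h \<le> k"
proof -
  obtain d where "lhom (map (\<lambda>x. x + d) xs) ys"
    using hom_imp_lhom_shift xs hom by (metis spans_def)
  then have "set (map (\<lambda>x. x + d) xs) \<subseteq> {0..k}" using lhom_set ys by (fastforce simp: spans_def)
  moreover have "0 + d \<in> set (map (\<lambda>x. x + d) xs)" "h + d \<in> set (map (\<lambda>x. x + d) xs)"
    using xs by (auto simp: spans_def)
  ultimately have "0 + d \<in> {0..k}" "h + d \<in> {0..k}" by blast+
  then show ?thesis by simp
qed

lemma dipath_list: "dipath k = list_digraph [0..int k]"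
  by (auto simp: dipath_def list_digraph_def adj_def nth_upto)

lemma spans_upto: "0 \<le> h \<Longrightarrow> spans h [0..h]"
  using level_list_upto[of 0 h] by (auto simp: spans_def)

lemma hom_upto:
  assumes "spans h xs" "h \<le> k" shows "hom (list_digraph xs) (list_digraph [0..k])"
proof (rule lhom_imp_hom)
  have r: "0 \<le> xs ! i \<and> xs ! i \<le> k" if "i < length xs" for i
  proof -
    have "xs ! i \<in> set xs" using that by simp
    then show ?thesis using assms by (force simp: spans_def)
  qed
  show "lhom xs [0..k]" unfolding lhom_iff_map
  proof (intro conjI exI[of _ "\<lambda>i. nat (xs ! i)"] allI impI)
    show "xs \<noteq> []" using assms by (auto simp: spans_def level_list_def)
    fix i assume "i < length xs"
    then show "nat (xs ! i) < length [0..k]" "[0..k] ! nat (xs ! i) = xs ! i"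
      using r[of i] by (auto simp: nth_upto)
  next
    fix i assume i: "Suc i < length xs"
    then have "\<bar>xs ! i - xs ! Suc i\<bar> = 1" using assms level_list_nth by (auto simp: spans_def)
    then show "adj (nat (xs ! i)) (nat (xs ! Suc i))" using r[of i] r[of "Suc i"] i by (auto simp: adj_def)
  qed
qed

lemma height_eq:
  assumes xs: "spans h xs" and G: "hom G (list_digraph xs)" "hom (list_digraph xs) G"
  shows "int (height G) = h"
proof -
  have h: "0 \<le> h" using xs by (auto simp: spans_def)
  have "hom G (dipath k) \<longleftrightarrow> h \<le> int k" for k
  proof
    assume "hom G (dipath k)"
    then have "hom (list_digraph xs) (list_digraph [0..int k])" using G hom_trans dipath_list by metis
    then show "h \<le> int k" using hom_spans_le[OF xs spans_upto] by simp
  next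
    assume "h \<le> int k"
    then show "hom G (dipath k)" using hom_upto[OF xs] G hom_trans dipath_list by metis
  qed
  then have "height G = (LEAST k. h \<le> int k)" by (simp add: height_def)
  also have "\<dots> = nat h" by (rule Least_equality) auto
  finally show ?thesis using h by simp
qed

lemma oriented_path_spans:
  assumes "oriented_path G"
  obtains xs where "spans (int (height G)) xs" "hom G (list_digraph xs)" "hom (list_digraph xs) G"
proof -
  obtain ys where ys: "level_list ys" "hom G (list_digraph ys)" "hom (list_digraph ys) G"
    using oriented_path_levels[OF assms] .
  define a b where "a = Min (set ys)" and "b = Max (set ys)"
  have ne: "set ys \<noteq> {}" using ys(1) by (simp add: level_list_def)
  then have ab: "a \<in> set ys" "b \<in> set ys" "\<And>y. y \<in> set ys \<Longrightarrow> a \<le> y \<and> y \<le> b"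
    by (auto simp: a_def b_def)
  define xs where "xs = map (\<lambda>x. x + - a) ys"
  have dg: "list_digraph xs = list_digraph ys" unfolding xs_def by (rule list_digraph_shift)
  have "level_list xs" unfolding xs_def level_list_shift by (rule ys)
  moreover have "set xs = (\<lambda>x. x + - a) ` set ys" by (simp add: xs_def)
  ultimately have "spans (b - a) xs" using ab by (auto simp: spans_def image_iff)
  then show ?thesis using that height_eq[of "b - a" xs G] ys dg by metis
qed

section \<open>Closed walks and paths of full height\<close>

lemma closed_doubling:
  assumes "i < length v"
  obtains u where "reads v u i i" "lhom v u"
proof -
  let ?t = "take (Suc i) v" and ?d = "drop i v"
  have v: "v \<noteq> []" using assms by auto
  have r: "reads v (rev ?t) i 0" "reads v v 0 (length v - 1)" "reads v (rev ?d) (length v - 1) i"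
    using reads_rev reads_take[OF assms] reads_drop[OF assms] reads_refl[OF v] by blast+
  \<comment> \<open>From \<open>i\<close> to the start, through all of \<open>v\<close>, and from
    its end back to \<open>i\<close>.\<close>
  have "reads v (rev ?t \<diamondop> (v \<diamondop> rev ?d)) i i" using r by (intro reads_fuse)
  moreover have "lhom v (rev ?t \<diamondop> (v \<diamondop> rev ?d))"
  proof -
    have "last (rev ?t) = hd v" using v by (cases v) auto
    then have "lhom (v \<diamondop> rev ?d) (rev ?t \<diamondop> (v \<diamondop> rev ?d))"
      using v by (intro lhom_fuse_right) (auto simp: fuse_nonempty hd_fuse)
    then show ?thesis using lhom_trans[OF lhom_fuse_left[OF v]] by blast
  qed
  ultimately show ?thesis by (rule that)
qed

lemma peaked_equivalent:
  assumes "spans h xs"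
  obtains D where "peaked h D" "lhom xs D" "lhom D xs"
proof -
  obtain i where i: "i < length xs" "xs ! i = 0" using assms by (auto simp: spans_def in_set_conv_nth)
  obtain D where D: "reads xs D i i" "lhom xs D" using closed_doubling[OF i(1)] .
  have "peaked h D" using assms reads_level_list[OF _ D(1)] reads_ends[OF D(1)] i lhom_set[OF D(2)]
    by (auto simp: peaked_def spans_def)
  then show ?thesis using that D lhomI by blast
qed

lemma slow_rev:
  assumes "slow h K u" shows "slow h K (rev u)"
proof -
  have "lhom (rev u) u \<or> u = []" using lhom_refl by (auto simp: lhom_rev_left)
  then show ?thesis using lhom_slow assms by fastforce
qed

text \<open>If bottom and top lie on different sides, the joint lies between them. Being extreme
  itself, it forms with one of the two a pair inside one part, and that pair is already far
  apart.\<close>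

lemma slow_fuse:
  assumes "slow h K u" "slow h K v" "u \<noteq> []" "v \<noteq> []" "last u = hd v" "hd v = 0 \<or> hd v = h"
  shows "slow h K (u \<diamondop> v)"
proof -
  define c where "c = length u - 1"
  have len: "length (u \<diamondop> v) = c + length v" using assms by (cases u) (auto simp: c_def length_fuse)
  have l: "(u \<diamondop> v) ! i = u ! i" "i < length u" if "i \<le> c" for i
  proof -
    show "i < length u" using that assms(3) by (cases u) (auto simp: c_def)
    then show "(u \<diamondop> v) ! i = u ! i" by (rule nth_fuse_left)
  qed
  have r: "(u \<diamondop> v) ! (c + i) = v ! i" for i
    unfolding c_def using assms by (intro nth_fuse_right)
  have joint: "u ! c = v ! 0" "c < length u" "v ! 0 = 0 \<or> v ! 0 = h" "0 < length v"
    using assms by (auto simp: c_def last_conv_nth hd_conv_nth)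
  have U: "int K \<le> \<bar>int i - int j\<bar>" if "i < length u" "j < length u" "u ! i = 0" "u ! j = h" for i j
    using assms(1) that by (auto simp: slow_def)
  have V: "int K \<le> \<bar>int i - int j\<bar>" if "i < length v" "j < length v" "v ! i = 0" "v ! j = h" for i j
    using assms(2) that by (auto simp: slow_def)
  show ?thesis unfolding slow_def
  proof (intro allI impI)
    fix i j assume a: "i < length (u \<diamondop> v)" "j < length (u \<diamondop> v)" "(u \<diamondop> v) ! i = 0" "(u \<diamondop> v) ! j = h"
    consider "i \<le> c" "j \<le> c" | i' j' where "i = c + i'" "j = c + j'" | j' where "i \<le> c" "j = c + j'"
      | i' where "i = c + i'" "j \<le> c"
      by (metis le_iff_add nat_le_linear)
    then show "int K \<le> \<bar>int i - int j\<bar>"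
    proof cases
      case 1
      then show ?thesis using U l a by simp
    next
      case 2
      then show ?thesis using V[of i' j'] r a len by simp
    next
      case 3
      then show ?thesis using U[of i c] V[of 0 j'] l[of i] r[of j'] a len joint by auto
    next
      case 4
      then show ?thesis using U[of c j] V[of i' 0] l[of j] r[of i'] a len joint by auto
    qed
  qed
qed

text \<open>If \<open>xs\<close> has neither extreme level, its image in \<open>D\<close> is
  prolonged to the next position at level 0 or \<open>h\<close>, which exists because
  \<open>D\<close> ends at 0. Stopping there admits one extreme only.\<close>

lemma reach_extreme:
  assumes D: "peaked h D" and h: "h \<noteq> 0" and xs: "lhom xs D" "\<not> (0 \<in> set xs \<and> h \<in> set xs)"
  obtains v where "lhom v D" "lhom xs v" "0 \<in> set v \<or> h \<in> set v" "\<not> (0 \<in> set v \<and> h \<in> set v)"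
proof (cases "0 \<in> set xs \<or> h \<in> set xs")
  case True
  have "lhom xs xs" by (rule lhom_refl) (use True in auto)
  then show ?thesis using that[of xs] True xs by blast
next
  case False
  obtain a b where ab: "reads D xs a b" using xs(1) by (auto simp: lhom_def)
  note abn = reads_ends[OF ab]
  define ext where "ext k \<longleftrightarrow> b \<le> k \<and> (D ! k = 0 \<or> D ! k = h)" for k
  define r where "r = (LEAST k. ext k)"
  have ex: "ext (length D - 1)" using abn(3) peakedD(3)[OF D] by (simp add: ext_def)
  then have "ext r" unfolding r_def by (rule LeastI)
  then have r: "b \<le> r" "D ! r = 0 \<or> D ! r = h" by (auto simp: ext_def)
  have "r \<le> length D - 1" unfolding r_def using ex by (rule Least_le)
  then have rl: "r < length D" using abn(3) by simp
  have before: "D ! k \<noteq> 0 \<and> D ! k \<noteq> h" if "b \<le> k" "k < r" for k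
    using not_less_Least[of k ext] that by (auto simp: ext_def r_def)
  define g where "g = map ((!) D) [b..<Suc r]"
  have g: "reads D g b r" unfolding g_def by (rule reads_between[OF r(1) rl])
  define v where "v = xs \<diamondop> g"
  have gn: "g \<noteq> []" "last xs = hd g" using reads_ends(1,4)[OF g] abn(5) by auto
  have "reads D v a r" unfolding v_def by (rule reads_fuse[OF ab g])
  then have vD: "lhom v D" by (rule lhomI)
  have xv: "lhom xs v" unfolding v_def by (rule lhom_fuse_left[OF abn(1)])
  have sv: "set v = set xs \<union> set g" unfolding v_def by (rule set_fuse[OF abn(1) gn])
  have sg: "x = D ! r \<or> (x \<noteq> 0 \<and> x \<noteq> h)" if x: "x \<in> set g" for x
  proof -
    obtain k where k: "b \<le> k" "k < Suc r" "x = D ! k" using x unfolding g_def by (auto simp del: upt_Suc)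
    then show ?thesis using before[of k] by (cases "k = r") auto
  qed
  have "D ! r \<in> set v" unfolding sv using reads_ends(1,5)[OF g] last_in_set by force
  then have one: "0 \<in> set v \<or> h \<in> set v" using r(2) by metis
  have "\<not> (0 \<in> set g \<and> h \<in> set g)" using sg[of 0] sg[of h] h by metis
  then have both: "\<not> (0 \<in> set v \<and> h \<in> set v)" using False unfolding sv by blast
  show ?thesis by (rule that[OF vD xv one both])
qed

text \<open>If \<^term>\<open>xs\<close> misses an extreme level, it extends to a closed walk at a single extreme, and adding
  slow connectors gives a path of full height too slow to receive \<^term>\<open>D\<close>.\<close>

lemma flat_extension:
  assumes D: "peaked h D" and h: "h \<ge> 3" and xs: "lhom xs D" "\<not> (0 \<in> set xs \<and> h \<in> set xs)"
  shows "\<exists>P. peaked h P \<and> lhom xs P \<and> lhom P D \<and> \<not> lhom D P"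
proof -
  obtain v where v: "lhom v D" "lhom xs v" "0 \<in> set v \<or> h \<in> set v" "\<not> (0 \<in> set v \<and> h \<in> set v)"
    using reach_extreme[OF D _ xs] h by auto
  obtain i where i: "i < length v" "v ! i = 0 \<or> v ! i = h" using v(3) by (auto simp: in_set_conv_nth)
  obtain u where u: "reads v u i i" "lhom v u" using closed_doubling[OF i(1)] .
  \<comment> \<open>The closed walk of \<open>v\<close> at \<open>i\<close> becomes a closed walk of
    \<open>D\<close> at an extreme position, where connectors inside \<open>D\<close> can be
    attached.\<close>
  obtain f where f: "\<And>i. i < length v \<Longrightarrow> f i < length D \<and> D ! f i = v ! i"
    "\<And>u p q. reads v u p q \<Longrightarrow> reads D u (f p) (f q)" using lhom_image[OF v(1)] by metis
  define p where "p = f i"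
  have p: "reads D u p p" "p < length D" "D ! p = v ! i" using f u(1) i by (auto simp: p_def)
  note un = reads_ends[OF p(1)]
  have su: "\<not> (0 \<in> set u \<and> h \<in> set u)" using reads_ends(6)[OF u(1)] v(4) by blast
  \<comment> \<open>A peaked list is longer than its slowness, so slowness \<open>length D\<close>
    cannot hold for \<open>D\<close>, nor for anything that receives \<open>D\<close>.\<close>
  define K where "K = length D"
  have slow_u: "slow h K u" using su nth_mem unfolding slow_def by metis
  have "level_list D \<and> set D \<subseteq> {0..h}" using D by (simp add: peaked_def)
  then obtain z where z: "crossing h z" "slow h K z"
    and rd: "\<And>a t. a < length D \<Longrightarrow> t < length D \<Longrightarrow> D ! a = 0 \<Longrightarrow> D ! t = h \<Longrightarrow> reads D z a t"
    using slow_connector[of "{D}" h K] h by auto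
  have zn: "z \<noteq> []" "hd z = 0" "last z = h" "h \<in> set z"
    using z(1) last_in_set by (auto simp: crossing_def level_list_def)
  have xu: "lhom xs u" using lhom_trans[OF v(2) u(2)] .
  have fin: ?thesis if P: "reads D P q q" "D ! q = 0" "lhom u P" "h \<in> set P" "slow h K P" for P q
  proof (intro exI[of _ P] conjI)
    show "peaked h P" using P(2,4) D reads_level_list[OF _ P(1)] reads_ends[OF P(1)] by (auto simp: peaked_def)
    show "lhom xs P" using lhom_trans[OF xu P(3)] .
    show "lhom P D" using P(1) by (rule lhomI)
    show "\<not> lhom D P" using lhom_slow[OF _ P(5)] slow_long[OF D, of K] K_def by blast
  qed
  show ?thesis
  proof (cases "D ! p = 0")
    case True
    obtain t where t: "t < length D" "D ! t = h" using peakedD[OF D] by blast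
    have "reads D z p t" using rd t p True by blast
    then have r: "reads D (u \<diamondop> (z \<diamondop> rev z)) p p" using p(1) by (intro reads_fuse) (auto intro: reads_rev)
    have "slow h K (z \<diamondop> rev z)" by (rule slow_fuse) (use z(2) slow_rev[OF z(2)] zn in \<open>auto simp: hd_rev\<close>)
    then have "slow h K (u \<diamondop> (z \<diamondop> rev z))"
      by (rule slow_fuse[OF slow_u]) (use un zn True in \<open>auto simp: fuse_nonempty hd_fuse\<close>)
    moreover have "h \<in> set (u \<diamondop> (z \<diamondop> rev z))"
      using un zn True by (simp add: set_fuse fuse_nonempty hd_fuse hd_rev)
    ultimately show ?thesis using fin[OF r True lhom_fuse_left[OF un(1)]] by blast
  next
    case False
    then have top: "D ! p = h" using p i by auto
    have "reads D z 0 p" using rd p top peakedD[OF D] by auto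
    then have r: "reads D (z \<diamondop> (u \<diamondop> rev z)) 0 0" using p(1) by (intro reads_fuse) (auto intro: reads_rev)
    have "slow h K (u \<diamondop> rev z)" 
      by (rule slow_fuse[OF slow_u slow_rev[OF z(2)]]) (use un zn top in \<open>auto simp: hd_rev\<close>)
    then have "slow h K (z \<diamondop> (u \<diamondop> rev z))"
      by (rule slow_fuse[OF z(2)]) (use un zn top in \<open>auto simp: fuse_nonempty hd_fuse\<close>)
    moreover have "h \<in> set (z \<diamondop> (u \<diamondop> rev z))"
      using un zn top by (simp add: set_fuse fuse_nonempty hd_fuse)
    moreover have "lhom u (z \<diamondop> (u \<diamondop> rev z))"
    proof -
      have "lhom (u \<diamondop> rev z) (z \<diamondop> (u \<diamondop> rev z))"
        using un zn top by (intro lhom_fuse_right) (auto simp: fuse_nonempty hd_fuse)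
      then show ?thesis using lhom_trans[OF lhom_fuse_left[OF un(1)]] by blast
    qed
    ultimately show ?thesis using fin[OF r] peakedD(2)[OF D] by blast
  qed
qed


subsection \<open>Intervals of oriented paths\<close>

lemma universal_interval:
  fixes P1 P2 :: "nat digraph"
  assumes P: "oriented_path P1" "oriented_path P2" "hom_lt P1 P2" and h: "height P2 \<ge> 4"
    and A: "countable A" and R: "partial_order_on A R"
  shows "\<exists>f. f ` A \<subseteq> path_interval P1 P2 \<and> (\<forall>x\<in>A. \<forall>y\<in>A. (x, y) \<in> R \<longleftrightarrow> hom (f x) (f y))"
proof -
  define H where "H = int (height P2)"
  have H: "H \<ge> 4" using h by (simp add: H_def)
  obtain ys where ys: "spans H ys" "hom P2 (list_digraph ys)" "hom (list_digraph ys) P2"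
    using oriented_path_spans[OF P(2)] unfolding H_def by metis
  obtain D where D: "peaked H D" "lhom ys D" "lhom D ys" using peaked_equivalent[OF ys(1)] by metis
  have DP: "hom (list_digraph D) P2" "hom P2 (list_digraph D)"
    using lhom_imp_hom[OF D(2)] lhom_imp_hom[OF D(3)] ys hom_trans by blast+
  obtain xs where xs: "level_list xs" "hom P1 (list_digraph xs)" "hom (list_digraph xs) P1"
    using oriented_path_levels[OF P(1)] .
  have "hom P1 P2" "\<not> hom P2 P1" using P(3) by (auto simp: hom_lt_def)
  then have "hom (list_digraph xs) (list_digraph D)" using xs(3) DP(2) hom_trans by blast
  then obtain k where k: "lhom (map (\<lambda>x. x + k) xs) D" using hom_imp_lhom_shift[OF xs(1)] by blast
  define us where "us = map (\<lambda>x. x + k) xs"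
  have us: "lhom us D" "level_list us" "hom P1 (list_digraph us)" "hom (list_digraph us) P1"
    using k xs by (auto simp: us_def list_digraph_shift level_list_shift)
  \<comment> \<open>The raised lower end: the closed form of \<open>P1\<close> if its image already
    meets both extremes, otherwise the path of \<open>flat_extension\<close>.\<close>
  obtain C where C: "peaked H C" "lhom us C" "lhom C D" "\<not> lhom D C"
  proof (cases "0 \<in> set us \<and> H \<in> set us")
    case True
    then have "spans H us" using us(2) lhom_set[OF us(1)] D(1) by (auto simp: spans_def peaked_def)
    then obtain C where C: "peaked H C" "lhom us C" "lhom C us" using peaked_equivalent by metis
    have "\<not> lhom D C"
    proof
      assume "lhom D C"
      then have "hom (list_digraph D) (list_digraph us)" using lhom_trans[OF _ C(3)] lhom_imp_hom by blast
      then show False using \<open>\<not> hom P2 P1\<close> DP(2) us(4) hom_trans by blast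
    qed
    then show ?thesis using that C lhom_trans[OF C(3) us(1)] by blast
  next
    case False
    then show ?thesis using flat_extension[OF D(1) _ us(1)] H that by force
  qed
  \<comment> \<open>The \<open>Suc\<close> keeps 0 free for the added least element.\<close>
  define e where "e x = Suc (to_nat_on A x)" for x
  have e: "e x = e y \<longleftrightarrow> x = y" if "x \<in> A" "y \<in> A" for x y
    using that A by (simp add: e_def)
  \<comment> \<open>Numbers that code no element of \<open>A\<close> are comparable with 0 and
    themselves only.\<close>
  define le where "le i j \<longleftrightarrow> i = 0 \<or> i = j \<or> (\<exists>x\<in>A. \<exists>y\<in>A. i = e x \<and> j = e y \<and> (x, y) \<in> R)" for i j
  have "trans R" "refl_on A R" using R by (auto simp: partial_order_on_def preorder_on_def)
  have le_e: "le (e x) (e y) \<longleftrightarrow> (x, y) \<in> R" if "x \<in> A" "y \<in> A" for x y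
    using that e \<open>refl_on A R\<close> unfolding le_def by (auto simp: e_def refl_on_def)
  have le_trans: "le i k" if l: "le i j" "le j k" for i j k
  proof (cases "i = 0 \<or> i = j \<or> j = k")
    case True
    then show ?thesis using l by (auto simp: le_def)
  next
    case False
    then obtain x y where xy: "x \<in> A" "y \<in> A" "i = e x" "j = e y" "(x, y) \<in> R"
      using l(1) unfolding le_def by blast
    then have "j \<noteq> 0" by (simp add: e_def)
    then obtain y' z where z: "y' \<in> A" "z \<in> A" "j = e y'" "k = e z" "(y', z) \<in> R"
      using l(2) False unfolding le_def by blast
    have "(x, z) \<in> R" using xy z e[of y y'] \<open>trans R\<close> by (auto dest: transD)
    then show ?thesis using xy z unfolding le_def by blast
  qed
  have "le i i" "le 0 i" for i by (auto simp: le_def)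
  then have "\<exists>W. (\<forall>i. peaked H (W i) \<and> lhom C (W i) \<and> lhom (W i) D) \<and>
      (\<forall>i j. lhom (W i) (W j) \<longleftrightarrow> le i j)"
    using C(1) D(1) C(3,4) H le_trans by (intro preorder_realized)
  then obtain W where W: "\<And>i. peaked H (W i) \<and> lhom C (W i) \<and> lhom (W i) D"
    "\<And>i j. lhom (W i) (W j) \<longleftrightarrow> le i j"
    by blast
  define f where "f x = list_digraph (W (e x))" for x
  have "f x \<in> path_interval P1 P2" for x
  proof -
    have "level_list (W (e x))" using W(1) by (auto simp: peaked_def)
    moreover have "lhom us (W (e x))" using W(1) lhom_trans[OF C(2)] by blast
    then have "hom P1 (f x)" using us(3) lhom_imp_hom hom_trans unfolding f_def by blast
    moreover have "hom (f x) P2" using W(1) DP(1) lhom_imp_hom hom_trans unfolding f_def by blast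
    ultimately show ?thesis by (simp add: path_interval_def f_def oriented_path_list_digraph)
  qed
  moreover have "(x, y) \<in> R \<longleftrightarrow> hom (f x) (f y)" if "x \<in> A" "y \<in> A" for x y
  proof -
    have "spans H (W (e x))" "spans H (W (e y))" using W(1) peaked_spans by blast+
    then show ?thesis using hom_iff_lhom W(2) le_e[OF that] by (simp add: f_def)
  qed
  ultimately show ?thesis by blast
qed

section \<open>Height at most 3\<close>

lemma even_level_diff:
  assumes xs: "level_list xs" and "i < length xs" "j < length xs"
  shows "even (xs ! i - xs ! j) \<longleftrightarrow> even (int i - int j)"
proof -
  have "i < length xs \<Longrightarrow> even (xs ! i - xs ! 0 - int i)" for i
  proof (induction i)
    case (Suc i)
    then have "\<bar>xs ! i - xs ! Suc i\<bar> = 1" using level_list_nth[OF xs] by blast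
    then show ?case using Suc by presburger
  qed simp
  from this[of i] this[of j] assms(2,3) show ?thesis by presburger
qed

text \<open>Up to height 2 every path is equivalent to a directed path. Height 3 is the first where
  this fails, since zigzags between levels 1 and 2 can avoid a straight passage from 0 to 3.\<close>

lemma short_straight:
  assumes ys: "spans k ys" and m: "0 \<le> m" "m \<le> 2" "m \<le> k"
  shows "\<exists>c. lhom (map (\<lambda>x. x + c) [0..m]) ys"
proof -
  have l: "level_list ys" "ys \<noteq> []" using ys by (auto simp: spans_def level_list_def)
  consider "m = 0" | "m = 1" | "m = 2" using m by linarith
  then show ?thesis
  proof cases
    case 1
    have "lhom [ys ! 0] ys" using reads_single[of 0 ys] l lhomI by auto
    then show ?thesis using 1 by (intro exI[of _ "ys ! 0"]) simp
  next
    case 2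
    have "ys \<noteq> [ys ! 0]" using ys 2 m by (auto simp: spans_def) (metis empty_iff empty_set insert_iff list.simps(15) zero_neq_one not_one_le_zero)
    then have n: "Suc 0 < length ys" using l(2) by (cases ys; cases "tl ys") auto
    have r: "reads ys [ys ! 0, ys ! 1] 0 1"
      using reads_snoc[OF reads_single[of 0 ys], of 1] n l(2) by (auto simp: adj_def)
    then have "lhom [ys ! 0, ys ! 1] ys" "lhom [ys ! 1, ys ! 0] ys" using lhomI reads_rev[OF r] by auto
    moreover have "ys ! 1 = ys ! 0 + 1 \<or> ys ! 0 = ys ! 1 + 1" using level_list_nth[OF l(1) n] by auto
    moreover have "map (\<lambda>x. x + c) [0..m] = [c, 1 + c]" for c using 2 by (simp add: upto.simps)
    ultimately show ?thesis by (metis add.commute)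
  next
    case 3
    have key: "lhom [0, 1, 2] zs"
      if zs: "level_list zs" "set zs \<subseteq> {0..k}" and ij: "i < j" "j < length zs" "zs ! i = 0" "zs ! j = k" for zs i j
    proof -
      \<comment> \<open>After the last bottom before the top, levels 1 and 2 must follow, as a
        return to 0 is excluded.\<close>
      define a where "a = Max {a. a < j \<and> zs ! a = 0}"
      have fin: "finite {a. a < j \<and> zs ! a = 0}" by simp
      have "a \<in> {a. a < j \<and> zs ! a = 0}" unfolding a_def by (rule Max_in[OF fin]) (use ij in auto)
      then have a: "a < j" "zs ! a = 0" by auto
      have later: "zs ! b \<noteq> 0" if "a < b" "b < j" for b
        using Max_ge[OF fin, of b] that unfolding a_def by fastforce
      have r: "0 \<le> zs ! b" if "b < length zs" for b
        using zs(2) nth_mem[OF that] by auto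
      have a1: "zs ! Suc a = 1"
        using level_list_nth[OF zs(1), of a] r[of "Suc a"] a ij by auto
      then have "Suc a \<noteq> j" using ij 3 m by auto
      then have sj: "Suc (Suc a) \<le> j" using a by simp
      have "zs ! Suc (Suc a) \<noteq> 0"
      proof (cases "Suc (Suc a) = j")
        case True
        then show ?thesis using ij 3 m by auto
      next
        case False
        then show ?thesis using later[of "Suc (Suc a)"] sj by auto
      qed
      then have a2: "zs ! Suc (Suc a) = 2"
        using level_list_nth[OF zs(1), of "Suc a"] r[of "Suc (Suc a)"] a1 sj ij by auto
      have "reads zs [zs ! a] a a" using a ij by (intro reads_single) auto
      from reads_snoc[OF reads_snoc[OF this, of "Suc a"], of "Suc (Suc a)"] show ?thesis
        using a a1 a2 sj ij lhomI by (auto simp: adj_def)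
    qed
    obtain i j where ij: "i < length ys" "j < length ys" "ys ! i = 0" "ys ! j = k"
      using ys by (auto simp: spans_def in_set_conv_nth)
    have "i \<noteq> j" using ij 3 m by auto
    have "lhom [0, 1, 2] ys"
    proof (cases "i < j")
      case True
      then show ?thesis using key[of ys i j] ys ij by (auto simp: spans_def)
    next
      case False
      define i' j' where "i' = length ys - Suc i" and "j' = length ys - Suc j"
      have "i' < j'" "j' < length (rev ys)" using False \<open>i \<noteq> j\<close> ij by (auto simp: i'_def j'_def)
      moreover have "rev ys ! i' = 0" "rev ys ! j' = k" using ij by (auto simp: i'_def j'_def rev_nth)
      ultimately have "lhom [0, 1, 2] (rev ys)"
        using key[of "rev ys" i' j'] ys by (auto simp: spans_def level_list_rev)
      then show ?thesis by (simp add: lhom_rev_right)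
    qed
    moreover have "map (\<lambda>x. x + 0) [0..m] = [0, 1, 2]" using 3 by (simp add: upto.simps)
    ultimately show ?thesis by metis
  qed
qed

text \<open>A vertex of \<^term>\<open>xs\<close> goes to the position at its distance \<open>r\<close> from the bottom level, as long
  as this stays inside the shortest crossing of \<^term>\<open>ys\<close>.\<close>

lemma lhom_height3:
  assumes xs: "spans 3 xs" "slow 3 d xs" and ys: "spans 3 ys" "slow 3 d ys"
    and ij: "i < j" "j < length ys" "ys ! i = 0" "ys ! j = 3" "j = i + d"
  shows "lhom xs ys"
proof -
  have lx: "level_list xs" "xs \<noteq> []" and ly: "level_list ys"
    using xs ys by (auto simp: spans_def level_list_def)
  have rx: "xs ! a \<in> {0, 1, 2, 3}" if "a < length xs" for a
  proof -
    have "xs ! a \<in> {0..3}" using xs(1) nth_mem[OF that] by (auto simp: spans_def)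
    then show ?thesis by auto
  qed
  have ry: "ys ! a \<in> {0, 1, 2, 3}" if "a < length ys" for a
  proof -
    have "ys ! a \<in> {0..3}" using ys(1) nth_mem[OF that] by (auto simp: spans_def)
    then show ?thesis by auto
  qed
  have slowy: "int d \<le> \<bar>int a - int b\<bar>" if "a < length ys" "b < length ys" "ys ! a = 0" "ys ! b = 3" for a b
    using ys(2) that by (auto simp: slow_def)
  have odd: "odd d"
    using even_level_diff[OF ly, of j i] ij by auto
  \<comment> \<open>By slowness neither 0 nor 3 occurs strictly inside the shortest crossing, and
    parity decides between 1 and 2.\<close>
  have seg: "ys ! (i + t) = (if t = 0 then 0 else if t = d then 3 else if odd t then 1 else 2)" if t: "t \<le> d" for t
  proof -
    have l: "i + t < length ys" using t ij by simp
    have "ys ! (i + t) \<noteq> 0" if "t \<noteq> 0" using slowy[of "i + t" j] that t l ij by auto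
    moreover have "ys ! (i + t) \<noteq> 3" if "t \<noteq> d" using slowy[of i "i + t"] that t l ij by auto
    moreover have "even (ys ! (i + t)) \<longleftrightarrow> even t"
      using even_level_diff[OF ly l, of i] ij by auto
    ultimately show ?thesis using ry[OF l] ij t by auto
  qed
  define Z where "Z = {b. b < length xs \<and> xs ! b = 0}"
  define r where "r a = Min ((\<lambda>b. nat \<bar>int a - int b\<bar>) ` Z)" for a
  have Z: "finite Z" "Z \<noteq> {}" using xs(1) by (auto simp: Z_def spans_def in_set_conv_nth)
  have r_in: "\<exists>b\<in>Z. int (r a) = \<bar>int a - int b\<bar>" for a
  proof -
    have "r a \<in> (\<lambda>b. nat \<bar>int a - int b\<bar>) ` Z" unfolding r_def using Z by (intro Min_in) auto
    then show ?thesis by auto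
  qed
  have r_le: "int (r a) \<le> \<bar>int a - int b\<bar>" if "b \<in> Z" for a b
  proof -
    have "r a \<le> nat \<bar>int a - int b\<bar>" unfolding r_def using Z(1) that by (intro Min_le) auto
    then show ?thesis by simp
  qed
  have r_parity: "even (r a) \<longleftrightarrow> even (xs ! a)" if "a < length xs" for a
  proof -
    obtain b where b: "b \<in> Z" "int (r a) = \<bar>int a - int b\<bar>" using r_in by blast
    then have z: "b < length xs" "xs ! b = 0" by (auto simp: Z_def)
    have "even (xs ! a) \<longleftrightarrow> even (int a - int b)"
      using even_level_diff[OF lx(1) that z(1)] z(2) by simp
    also have "\<dots> \<longleftrightarrow> even (int (r a))" unfolding b(2) by simp
    finally show ?thesis by simp
  qed
  have r_zero: "r a = 0 \<longleftrightarrow> xs ! a = 0" if "a < length xs" for a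
  proof
    assume "r a = 0"
    then show "xs ! a = 0" using r_in[of a] by (auto simp: Z_def)
  next
    assume "xs ! a = 0"
    then show "r a = 0" using r_le[of a a] that by (auto simp: Z_def)
  qed
  \<comment> \<open>Slowness of \<open>xs\<close> makes every neighbour of a top lie at distance at
    least \<open>d - 1\<close> from the bottom level, so it goes to \<open>d - 1\<close>, next to
    the end of the crossing.\<close>
  have r_top: "d \<le> r a" if "a < length xs" "xs ! a = 3" for a
  proof -
    obtain b where b: "b \<in> Z" "int (r a) = \<bar>int a - int b\<bar>" using r_in by blast
    then have "int d \<le> \<bar>int b - int a\<bar>" using xs(2) that by (auto simp: Z_def slow_def)
    then show ?thesis using b(2) by linarith
  qed
  have r_lip: "r a \<le> Suc (r (Suc a))" "r (Suc a) \<le> Suc (r a)" for a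
  proof -
    obtain b where b: "b \<in> Z" "int (r (Suc a)) = \<bar>int (Suc a) - int b\<bar>" using r_in by blast
    then show "r a \<le> Suc (r (Suc a))" using r_le[OF b(1), of a] by linarith
    obtain c where c: "c \<in> Z" "int (r a) = \<bar>int a - int c\<bar>" using r_in by blast
    then show "r (Suc a) \<le> Suc (r a)" using r_le[OF c(1), of "Suc a"] by linarith
  qed
  have d3: "d \<ge> 3"
  proof -
    have "d \<noteq> 1" using level_list_nth[OF ly, of i] ij by auto
    then show ?thesis using odd by presburger
  qed
  \<comment> \<open>Vertices at distance \<open>d\<close> or more are parked just before the end of
    the crossing, at \<open>d - 2\<close> or \<open>d - 1\<close>; as \<open>d\<close> is odd, these
    positions have levels 1 and 2.\<close>
  define g where "g a = (if xs ! a = 3 then d else if r a < d then r a else if xs ! a = 1 then d - 2 else d - 1)" for a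
  show ?thesis unfolding lhom_iff_map
  proof (intro conjI exI[of _ "\<lambda>a. i + g a"] allI impI)
    show "xs \<noteq> []" by (rule lx)
  next
    fix a assume a: "a < length xs"
    have g: "g a \<le> d" by (auto simp: g_def)
    then show "i + g a < length ys" using ij by simp
    have "(if g a = 0 then 0 else if g a = d then 3 else if odd (g a) then 1 else 2) = xs ! a"
    proof -
      consider "xs ! a = 0" | "xs ! a = 1" | "xs ! a = 2" | "xs ! a = 3" using rx[OF a] by auto
      then show ?thesis
      proof cases
        case 1
        then show ?thesis using r_zero[OF a] d3 by (simp add: g_def)
      next
        case 2
        then have "odd (r a)" using r_parity[OF a] by simp
        moreover have "odd (d - 2)" "d - 2 \<noteq> d" "r a \<noteq> 0" using odd d3 odd_pos[OF \<open>odd (r a)\<close>] by auto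
        ultimately show ?thesis using 2 d3 by (auto simp: g_def)
      next
        case 3
        then have "even (r a)" "r a \<noteq> 0" using r_parity[OF a] r_zero[OF a] by simp_all
        moreover have "even (d - 1)" "d - 1 \<noteq> d" "d - 1 \<noteq> 0" using odd d3 by auto
        ultimately show ?thesis using 3 by (auto simp: g_def)
      next
        case 4
        then show ?thesis using d3 by (simp add: g_def)
      qed
    qed
    then show "ys ! (i + g a) = xs ! a" using seg[OF g] by simp
  next
    fix a assume a: "Suc a < length xs"
    then have a': "a < length xs" by simp
    have "\<bar>xs ! a - xs ! Suc a\<bar> = 1" by (rule level_list_nth[OF lx(1) a])
    then consider "xs ! a = 0" "xs ! Suc a = 1" | "xs ! a = 1" "xs ! Suc a = 0"
      | "xs ! a = 1" "xs ! Suc a = 2" | "xs ! a = 2" "xs ! Suc a = 1"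
      | "xs ! a = 2" "xs ! Suc a = 3" | "xs ! a = 3" "xs ! Suc a = 2"
      using rx[OF a] rx[OF a'] by auto
    moreover have "r a \<noteq> r (Suc a)"
      using r_parity[OF a] r_parity[OF a'] level_list_nth[OF lx(1) a] by presburger
    then have near: "r a = Suc (r (Suc a)) \<or> r (Suc a) = Suc (r a)" using r_lip[of a] by linarith
    \<comment> \<open>By parity no vertex of level 1 is at distance \<open>d - 1\<close>, so the
      change from distances to parking positions makes no jump.\<close>
    moreover have one: "r b \<noteq> d - 1" if "b < length xs" "xs ! b = 1" for b
      using r_parity[OF that(1)] that(2) odd by auto
    ultimately show "adj (i + g a) (i + g (Suc a))"
    proof cases
      case 1
      then show ?thesis using r_zero[OF a'] near d3 by (auto simp: g_def adj_def)
    next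
      case 2
      then show ?thesis using r_zero[OF a] near d3 by (auto simp: g_def adj_def)
    next
      case 3
      then show ?thesis using one[OF a'] near d3 by (auto simp: g_def adj_def)
    next
      case 4
      then show ?thesis using one[OF a] near d3 by (auto simp: g_def adj_def)
    next
      case 5
      then show ?thesis using r_top[OF a] near d3 by (auto simp: g_def adj_def)
    next
      case 6
      then show ?thesis using r_top[OF a'] near d3 by (auto simp: g_def adj_def)
    qed
  qed
qed

lemma slow_distance:
  assumes "spans h xs"
  obtains d where "slow h d xs"
    "\<exists>i<length xs. \<exists>j<length xs. xs ! i = 0 \<and> xs ! j = h \<and> \<bar>int i - int j\<bar> = int d"
proof -
  define S where "S = {nat \<bar>int i - int j\<bar> | i j. i < length xs \<and> j < length xs \<and> xs ! i = 0 \<and> xs ! j = h}"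
  have "S \<subseteq> (\<lambda>(i, j). nat \<bar>int i - int j\<bar>) ` ({..<length xs} \<times> {..<length xs})"
    unfolding S_def by auto
  then have fin: "finite S" by (rule finite_subset) simp
  have ne: "S \<noteq> {}" using assms unfolding S_def by (auto simp: spans_def in_set_conv_nth)
  obtain i j where ij: "i < length xs" "j < length xs" "xs ! i = 0" "xs ! j = h" "Min S = nat \<bar>int i - int j\<bar>"
    using Min_in[OF fin ne] unfolding S_def by auto
  have "slow h (Min S) xs" unfolding slow_def
  proof (intro allI impI)
    fix a b assume "a < length xs" "b < length xs" "xs ! a = 0" "xs ! b = h"
    then have "nat \<bar>int a - int b\<bar> \<in> S" unfolding S_def by blast
    then have "Min S \<le> nat \<bar>int a - int b\<bar>" using fin by simp
    then show "int (Min S) \<le> \<bar>int a - int b\<bar>" by simp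
  qed
  then show ?thesis using that ij by (metis abs_ge_zero nat_0_le)
qed

text \<open>With smaller height at most 2, that path is a directed one up to equivalence and maps to
  the other. At height 3 the path whose bottom and top are farther apart maps to the other; if the
  shortest crossing of the target runs downwards, the target is reversed.\<close>

lemma low_chain:
  assumes xs: "spans m xs" and ys: "spans k ys" and mk: "m \<le> k" "k \<le> 3"
  shows "hom (list_digraph xs) (list_digraph ys) \<or> hom (list_digraph ys) (list_digraph xs)"
proof (cases "m \<le> 2")
  case True
  have "0 \<le> m" using xs by (auto simp: spans_def)
  then obtain c where "lhom (map (\<lambda>x. x + c) [0..m]) ys" using short_straight[OF ys _ True mk(1)] by blast
  then have "hom (list_digraph [0..m]) (list_digraph ys)" using lhom_imp_hom list_digraph_shift by metis
  then show ?thesis using hom_upto[OF xs order_refl] hom_trans by blast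
next
  case False
  then have m: "m = 3" "k = 3" using mk by auto
  have main: "lhom us vs" if us: "spans 3 us" "slow 3 d us" and vs: "spans 3 vs" "slow 3 d vs"
     "\<exists>i<length vs. \<exists>j<length vs. vs ! i = 0 \<and> vs ! j = 3 \<and> \<bar>int i - int j\<bar> = int d" for us vs d
  proof -
    obtain i j where ij: "i < length vs" "j < length vs" "vs ! i = 0" "vs ! j = 3" "\<bar>int i - int j\<bar> = int d"
      using vs(3) by blast
    have "i \<noteq> j" using ij by auto
    show ?thesis
    proof (cases "i < j")
      case True
      then have "j = i + d" using ij by simp
      with True show ?thesis using lhom_height3[OF us vs(1,2), of i j] ij by simp
    next
      case False
      define i' j' where "i' = length vs - Suc i" and "j' = length vs - Suc j"
      have "i' < j'" "j' < length (rev vs)" "j' = i' + d"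
        using False \<open>i \<noteq> j\<close> ij by (auto simp: i'_def j'_def)
      moreover have "rev vs ! i' = 0" "rev vs ! j' = 3" using ij by (auto simp: i'_def j'_def rev_nth)
      moreover have "spans 3 (rev vs)" using vs(1) by (simp add: spans_def level_list_rev)
      ultimately have "lhom us (rev vs)" using lhom_height3[OF us _ slow_rev[OF vs(2)]] by blast
      then show ?thesis by (simp add: lhom_rev_right)
    qed
  qed
  obtain d where d: "slow 3 d xs" "\<exists>i<length xs. \<exists>j<length xs. xs ! i = 0 \<and> xs ! j = 3 \<and> \<bar>int i - int j\<bar> = int d"
    using slow_distance[OF xs] m by metis
  obtain e where e: "slow 3 e ys" "\<exists>i<length ys. \<exists>j<length ys. ys ! i = 0 \<and> ys ! j = 3 \<and> \<bar>int i - int j\<bar> = int e"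
    using slow_distance[OF ys] m by metis
  have mono: "slow 3 a us" if "slow 3 b us" "a \<le> b" for a b us
    using that by (fastforce simp: slow_def)
  show ?thesis
  proof (cases "e \<le> d")
    case True
    then show ?thesis using main[of xs e ys] mono d e xs ys m lhom_imp_hom by blast
  next
    case False
    then show ?thesis using main[of ys d xs] mono[of e ys d] d e xs ys m lhom_imp_hom by auto
  qed
qed

theorem theorem2:
  fixes P1 P2 :: "nat digraph"
  assumes "oriented_path P1" and "oriented_path P2" and "hom_lt P1 P2"
  shows "(height P2 \<ge> 4 \<longrightarrow>
           (\<forall>(A :: 'a set) R. countable A \<and> partial_order_on A R \<longrightarrow>
              (\<exists>f. f ` A \<subseteq> path_interval P1 P2 \<and>
                   (\<forall>x\<in>A. \<forall>y\<in>A. (x, y) \<in> R \<longleftrightarrow> hom (f x) (f y)))))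
       \<and> (height P2 \<le> 3 \<longrightarrow>
           (\<forall>P\<in>path_interval P1 P2. \<forall>Q\<in>path_interval P1 P2. hom P Q \<or> hom Q P))"
proof (intro conjI impI allI ballI)
  fix A :: "'a set" and R
  assume "4 \<le> height P2" "countable A \<and> partial_order_on A R"
  then show "\<exists>f. f ` A \<subseteq> path_interval P1 P2 \<and> (\<forall>x\<in>A. \<forall>y\<in>A. (x, y) \<in> R \<longleftrightarrow> hom (f x) (f y))"
    using universal_interval[OF assms] by blast
next
  fix P Q assume h: "height P2 \<le> 3" and PQ: "P \<in> path_interval P1 P2" "Q \<in> path_interval P1 P2"
  obtain zs where zs: "spans (int (height P2)) zs" "hom P2 (list_digraph zs)"
    using oriented_path_spans[OF assms(2)] by metis
  obtain xs where xs: "spans (int (height P)) xs" "hom P (list_digraph xs)" "hom (list_digraph xs) P"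
    using oriented_path_spans[of P] PQ(1) unfolding path_interval_def by blast
  obtain ys where ys: "spans (int (height Q)) ys" "hom Q (list_digraph ys)" "hom (list_digraph ys) Q"
    using oriented_path_spans[of Q] PQ(2) unfolding path_interval_def by blast
  have "hom P P2" "hom Q P2" using PQ by (auto simp: path_interval_def)
  then have "hom (list_digraph xs) (list_digraph zs)" "hom (list_digraph ys) (list_digraph zs)"
    using xs(3) ys(3) zs(2) hom_trans by blast+
  then have "height P \<le> 3" "height Q \<le> 3"
    using hom_spans_le[OF xs(1) zs(1)] hom_spans_le[OF ys(1) zs(1)] h by auto
  then have "hom (list_digraph xs) (list_digraph ys) \<or> hom (list_digraph ys) (list_digraph xs)"
    using low_chain[OF xs(1) ys(1)] low_chain[OF ys(1) xs(1)] by linarith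
  then show "hom P Q \<or> hom Q P" using xs ys hom_trans by blast
qed

end
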